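(* Let $\alpha>-1$ and $i\in\mathbb{S}$. For $q,w\in\mathbb{D}$ with $q=q_0+i_qq_1$, $w=w_0+i_ww_1$, set $q_{i_w}=q_0+i_wq_1$ and $$K_\alpha(q,w):=\tfrac12(1-i_qi_w)\frac{1}{(1-q_{i_w}\overline{w})^{2+\alpha}}+\tfrac12(1+i_qi_w)\frac{1}{(1-\overline{q_{i_w}}\,\overline{w})^{2+\alpha}}.$$ Then $K_\alpha(\cdot,\cdot)$ is the reproducing kernel of $\mathcal{A}^2_{\alpha,i}(\mathbb{D})$; that is, for every $w\in\mathbb{D}$ the function $K_w:=K_\alpha(\cdot,w)$ belongs to $\mathcal{A}^2_{\alpha,i}(\mathbb{D})$ and $\langle K_w,f\rangle_{2,\alpha,i}=f(w)$ for all $f\in\mathcal{A}^2_{\alpha,i}(\mathbb{D})$.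
   Context: $\mathbb{H}$ denotes the quaternions, $\mathbb{D}$ its open unit ball, $\mathbb{S}=\{x\in\mathbb{H}:\operatorname{Re}(x)=0,\ |x|=1\}$, $\mathbb{C}_i=\{a+ib:a,b\in\mathbb{R}\}$, $\mathbb{D}_i=\mathbb{D}\cap\mathbb{C}_i$, and $dm_i$ is Lebesgue measure on $\mathbb{C}_i$. Every $x\in\mathbb{H}$ is written $x=x_0+i_xx_1$ with $x_0=\operatorname{Re}(x)$, $x_1=|x-x_0|\ge0$, and $i_x=(x-x_0)/x_1$ if $x_1\ne0$, $i_x$ any element of $\mathbb{S}$ if $x$ is real (the formulas do not depend on the choice). Powers with exponent $2+\alpha$ are principal branches in the complex plane $\mathbb{C}_{i_w}$. A real differentiable $f:\mathbb{D}\to\mathbb{H}$ is left slice hyperholomorphic if $f(x)=u(x_0,x_1)+i_xv(x_0,x_1)$ with $\mathbb{H}$-valued $u,v$ satisfying $u(x_0,x_1)=u(x_0,-x_1)$, $v(x_0,x_1)=-v(x_0,-x_1)$, $\partial_{x_0}u=\partial_{x_1}v$ and $\partial_{x_0}v=-\partial_{x_1}u$. $dA_{\alpha,i}(z)=\frac{\alpha+1}{\pi}(1-|z|^2)^\alpha dm_i(z)$ on $\mathbb{D}_i$. $\mathcal{A}^2_{\alpha,i}(\mathbb{D})$ is the right $\mathbb{H}$-vector space of all left slice hyperholomorphic $f$ on $\mathbb{D}$ with $\int_{\mathbb{D}_i}|f|^2dA_{\alpha,i}<\infty$, with scalar product $\langle f,g\rangle_{2,\alpha,i}=\int_{\mathbb{D}_i}\overline{f(z)}g(z)\,dA_{\alpha,i}(z)$.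 *)

theory Defs
  imports "HOL-Analysis.Analysis"
begin

section \<open>The quaternions\<close>

datatype quat = Quat (qRe: real) (qI: real) (qJ: real) (qK: real)

lemma quat_eq_iff: "x = y \<longleftrightarrow> qRe x = qRe y \<and> qI x = qI y \<and> qJ x = qJ y \<and> qK x = qK y"
  by (cases x; cases y) auto

lemma quat_eqI: "qRe x = qRe y \<Longrightarrow> qI x = qI y \<Longrightarrow> qJ x = qJ y \<Longrightarrow> qK x = qK y \<Longrightarrow> x = y"
  by (simp add: quat_eq_iff)

instantiation quat :: ring_1
begin

definition zero_quat :: quat where "0 = Quat 0 0 0 0"
definition one_quat :: quat where "1 = Quat 1 0 0 0"
definition plus_quat :: "quat \<Rightarrow> quat \<Rightarrow> quat" where
  "x + y = Quat (qRe x + qRe y) (qI x + qI y) (qJ x + qJ y) (qK x + qK y)"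
definition uminus_quat :: "quat \<Rightarrow> quat" where
  "- x = Quat (- qRe x) (- qI x) (- qJ x) (- qK x)"
definition minus_quat :: "quat \<Rightarrow> quat \<Rightarrow> quat" where
  "x - y = Quat (qRe x - qRe y) (qI x - qI y) (qJ x - qJ y) (qK x - qK y)"
definition times_quat :: "quat \<Rightarrow> quat \<Rightarrow> quat" where
  "x * y = Quat
     (qRe x * qRe y - qI x * qI y - qJ x * qJ y - qK x * qK y)
     (qRe x * qI y + qI x * qRe y + qJ x * qK y - qK x * qJ y)
     (qRe x * qJ y - qI x * qK y + qJ x * qRe y + qK x * qI y)
     (qRe x * qK y + qI x * qJ y - qJ x * qI y + qK x * qRe y)"

instance
  by standard
    (simp_all add: quat_eq_iff zero_quat_def one_quat_def plus_quat_def uminus_quat_def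
      minus_quat_def times_quat_def algebra_simps)

end

lemma quat_sel_simps [simp]:
  "qRe 0 = 0" "qI 0 = 0" "qJ 0 = 0" "qK 0 = 0"
  "qRe 1 = 1" "qI 1 = 0" "qJ 1 = 0" "qK 1 = 0"
  "qRe (x + y) = qRe x + qRe y" "qI (x + y) = qI x + qI y"
  "qJ (x + y) = qJ x + qJ y" "qK (x + y) = qK x + qK y"
  "qRe (- x) = - qRe x" "qI (- x) = - qI x" "qJ (- x) = - qJ x" "qK (- x) = - qK x"
  "qRe (x - y) = qRe x - qRe y" "qI (x - y) = qI x - qI y"
  "qJ (x - y) = qJ x - qJ y" "qK (x - y) = qK x - qK y"
  by (simp_all add: zero_quat_def one_quat_def plus_quat_def uminus_quat_def minus_quat_def)

lemma quat_times_sel: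
  "qRe (x * y) = qRe x * qRe y - qI x * qI y - qJ x * qJ y - qK x * qK y"
  "qI (x * y) = qRe x * qI y + qI x * qRe y + qJ x * qK y - qK x * qJ y"
  "qJ (x * y) = qRe x * qJ y - qI x * qK y + qJ x * qRe y + qK x * qI y"
  "qK (x * y) = qRe x * qK y + qI x * qJ y - qJ x * qI y + qK x * qRe y"
  by (simp_all add: times_quat_def)

instantiation quat :: real_algebra_1
begin

definition scaleR_quat :: "real \<Rightarrow> quat \<Rightarrow> quat" where
  "r *\<^sub>R x = Quat (r * qRe x) (r * qI x) (r * qJ x) (r * qK x)"

instance
  by standard (simp_all add: quat_eq_iff scaleR_quat_def quat_times_sel algebra_simps)

end

lemma quat_scaleR_sel [simp]:
  "qRe (r *\<^sub>R x) = r * qRe x" "qI (r *\<^sub>R x) = r * qI x"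
  "qJ (r *\<^sub>R x) = r * qJ x" "qK (r *\<^sub>R x) = r * qK x"
  by (simp_all add: scaleR_quat_def)

lemma quat_of_real_sel [simp]:
  "qRe (of_real r) = r" "qI (of_real r) = 0" "qJ (of_real r) = 0" "qK (of_real r) = 0"
  by (simp_all add: of_real_def)

definition qcnj :: "quat \<Rightarrow> quat" where
  "qcnj x = Quat (qRe x) (- qI x) (- qJ x) (- qK x)"

instantiation quat :: real_inner
begin

definition inner_quat :: "quat \<Rightarrow> quat \<Rightarrow> real" where
  "inner x y = qRe x * qRe y + qI x * qI y + qJ x * qJ y + qK x * qK y"
definition norm_quat :: "quat \<Rightarrow> real" where
  "norm x = sqrt ((qRe x)\<^sup>2 + (qI x)\<^sup>2 + (qJ x)\<^sup>2 + (qK x)\<^sup>2)"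
definition sgn_quat :: "quat \<Rightarrow> quat" where
  "sgn x = (x::quat) /\<^sub>R norm x"
definition dist_quat :: "quat \<Rightarrow> quat \<Rightarrow> real" where
  "dist x y = norm (x - y :: quat)"
definition uniformity_quat :: "(quat \<times> quat) filter" where
  "uniformity = (INF e\<in>{0<..}. principal {(x, y). dist x (y::quat) < e})"
definition open_quat :: "quat set \<Rightarrow> bool" where
  "open (U :: quat set) \<longleftrightarrow> (\<forall>x\<in>U. eventually (\<lambda>(x', y). x' = x \<longrightarrow> y \<in> U) uniformity)"

instance
proof
  fix x y z :: quat and r :: real
  show "dist x y = norm (x - y)" by (rule dist_quat_def)
  show "sgn x = x /\<^sub>R norm x" by (rule sgn_quat_def)
  show "uniformity = (INF e\<in>{0<..}. principal {(x, y). dist x (y::quat) < e})"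
    by (rule uniformity_quat_def)
  show "open U \<longleftrightarrow> (\<forall>x\<in>U. \<forall>\<^sub>F (x', y) in uniformity. x' = x \<longrightarrow> y \<in> U)" for U :: "quat set"
    by (rule open_quat_def)
  show "inner x y = inner y x" by (simp add: inner_quat_def mult.commute)
  show "inner (x + y) z = inner x z + inner y z" by (simp add: inner_quat_def algebra_simps)
  show "inner (r *\<^sub>R x) y = r * inner x y" by (simp add: inner_quat_def algebra_simps)
  show "0 \<le> inner x x" by (simp add: inner_quat_def)
  show "inner x x = 0 \<longleftrightarrow> x = 0"
  proof
    assume "inner x x = 0"
    then have "(qRe x)\<^sup>2 + (qI x)\<^sup>2 + (qJ x)\<^sup>2 + (qK x)\<^sup>2 = 0"
      by (simp add: inner_quat_def power2_eq_square)
    then show "x = 0" by (simp add: add_nonneg_eq_0_iff quat_eq_iff)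
  qed (simp add: inner_quat_def)
  show "norm x = sqrt (inner x x)" by (simp add: inner_quat_def norm_quat_def power2_eq_square)
qed

end

instantiation quat :: real_normed_div_algebra
begin

definition inverse_quat :: "quat \<Rightarrow> quat" where
  "inverse x = qcnj x /\<^sub>R (norm x)\<^sup>2"
definition divide_quat :: "quat \<Rightarrow> quat \<Rightarrow> quat" where
  "x div y = x * inverse (y::quat)"

lemma quat_norm_sq: "(norm x)\<^sup>2 = (qRe x)\<^sup>2 + (qI x)\<^sup>2 + (qJ x)\<^sup>2 + (qK x)\<^sup>2" for x :: quat
  by (simp add: norm_quat_def)

instance
proof
  fix x y :: quat
  have cnj: "x * qcnj x = of_real ((norm x)\<^sup>2)" "qcnj x * x = of_real ((norm x)\<^sup>2)"
    by (simp_all add: quat_eq_iff quat_times_sel qcnj_def quat_norm_sq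
        del: of_real_power of_real_add) (simp_all add: power2_eq_square)
  show "inverse x * x = 1" "x * inverse x = 1" if "x \<noteq> 0"
  proof -
    have "inverse ((norm x)\<^sup>2) * (norm x)\<^sup>2 = 1" using that by simp
    then show "inverse x * x = 1" "x * inverse x = 1"
      unfolding inverse_quat_def mult_scaleR_left mult_scaleR_right cnj of_real_def scaleR_scaleR
      by simp_all
  qed
  show "x div y = x * inverse y" by (rule divide_quat_def)
  show "inverse (0::quat) = 0" by (simp add: inverse_quat_def)
  have "(norm (x * y))\<^sup>2 = (norm x * norm y)\<^sup>2"
    unfolding power_mult_distrib quat_norm_sq quat_times_sel
    by (simp add: power2_eq_square algebra_simps)
  then show "norm (x * y) = norm x * norm y"
    by (metis norm_ge_zero power2_eq_iff_nonneg mult_nonneg_nonneg)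
qed

end

instantiation quat :: euclidean_space
begin

definition Basis_quat :: "quat set" where
  "Basis = {Quat 1 0 0 0, Quat 0 1 0 0, Quat 0 0 1 0, Quat 0 0 0 1}"

instance
proof
  fix x y :: quat
  show "(Basis :: quat set) \<noteq> {}" "finite (Basis :: quat set)"
    by (simp_all add: Basis_quat_def)
  show "inner x y = (if x = y then 1 else 0)" if "x \<in> Basis" "y \<in> Basis"
    using that unfolding Basis_quat_def insert_iff empty_iff
    by (elim disjE FalseE; simp add: inner_quat_def)
  show "(\<forall>b\<in>Basis. inner x b = 0) \<longleftrightarrow> x = 0"
    by (cases x) (simp add: Basis_quat_def inner_quat_def zero_quat_def)
qed

end

section \<open>Slices\<close>

definition im_sphere :: "quat set" where
  "im_sphere = {x. qRe x = 0 \<and> norm x = 1}"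

definition im_norm :: "quat \<Rightarrow> real" where
  "im_norm x = norm (x - of_real (qRe x))"

text \<open>\<open>im_unit_of x i\<close> says that \<open>i\<close> is an admissible value of \<open>i_x\<close>:
  it is determined for non-real \<open>x\<close> and arbitrary in the sphere for real \<open>x\<close>.\<close>

definition im_unit_of :: "quat \<Rightarrow> quat \<Rightarrow> bool" where
  "im_unit_of x i \<longleftrightarrow>
     i \<in> im_sphere \<and> (im_norm x \<noteq> 0 \<longrightarrow> i = (x - of_real (qRe x)) / of_real (im_norm x))"

definition slice_embed :: "quat \<Rightarrow> complex \<Rightarrow> quat" where
  "slice_embed i z = of_real (Re z) + i * of_real (Im z)"

definition slice_disc :: "quat \<Rightarrow> quat set" where
  "slice_disc i = ball 0 1 \<inter> range (slice_embed i)"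

text \<open>For \<open>i\<close> in the sphere and \<open>x = a + i b\<close>, the complex number \<open>Complex (qRe x) (inner i x)\<close>
  is \<open>a + \<i> b\<close>, so this is the principal power transported to the plane of \<open>i\<close>.\<close>

definition slice_powr :: "quat \<Rightarrow> quat \<Rightarrow> real \<Rightarrow> quat" where
  "slice_powr i x s = slice_embed i (Complex (qRe x) (inner i x) powr of_real s)"

section \<open>Slice hyperholomorphic functions and weighted Bergman spaces\<close>

text \<open>Functions on the open unit ball are modelled by total functions whose values outside
  \<open>ball 0 1\<close> are ignored.  In the Cauchy--Riemann system, \<open>p\<close> is the common value of
  \<open>\<partial>u/\<partial>a\<close> and \<open>\<partial>v/\<partial>b\<close>, and \<open>r\<close> that of \<open>\<partial>v/\<partial>a\<close> and \<open>-\<partial>u/\<partial>b\<close>.\<close>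

definition slice_hyperholomorphic :: "(quat \<Rightarrow> quat) \<Rightarrow> bool" where
  "slice_hyperholomorphic f \<longleftrightarrow>
     f differentiable_on ball 0 1 \<and>
     (\<exists>u v :: real \<Rightarrow> real \<Rightarrow> quat.
        (\<forall>x\<in>ball 0 1. \<forall>i. im_unit_of x i \<longrightarrow>
            f x = u (qRe x) (im_norm x) + i * v (qRe x) (im_norm x)) \<and>
        (\<forall>a b. a\<^sup>2 + b\<^sup>2 < 1 \<longrightarrow>
            u a b = u a (- b) \<and> v a b = - v a (- b) \<and>
            (\<exists>p r.
               ((\<lambda>s. u s b) has_vector_derivative p) (at a) \<and>
               ((\<lambda>t. v a t) has_vector_derivative p) (at b) \<and>
               ((\<lambda>s. v s b) has_vector_derivative r) (at a) \<and>
               ((\<lambda>t. u a t) has_vector_derivative (- r)) (at b))))"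

text \<open>The measure \<open>dA\<close>, as a measure on the quaternions concentrated on the plane of \<open>i\<close>.
  It is meant to be integrated over \<open>slice_disc i\<close> only, outside of which the density has
  no meaning.\<close>

definition slice_measure :: "real \<Rightarrow> quat \<Rightarrow> quat measure" where
  "slice_measure \<alpha> i =
     density (distr lborel borel (slice_embed i))
       (\<lambda>z. ennreal ((\<alpha> + 1) / pi * (1 - (norm z)\<^sup>2) powr \<alpha>))"

definition bergman_space :: "real \<Rightarrow> quat \<Rightarrow> (quat \<Rightarrow> quat) set" where
  "bergman_space \<alpha> i =
     {f. slice_hyperholomorphic f \<and>
         (\<integral>\<^sup>+z\<in>slice_disc i. ennreal ((norm (f z))\<^sup>2) \<partial>slice_measure \<alpha> i) < \<infinity>}"

definition bergman_inner :: "real \<Rightarrow> quat \<Rightarrow> (quat \<Rightarrow> quat) \<Rightarrow> (quat \<Rightarrow> quat) \<Rightarrow> quat" where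
  "bergman_inner \<alpha> i f g = (LINT z:slice_disc i|slice_measure \<alpha> i. qcnj (f z) * g z)"

text \<open>The function \<open>J\<close> selects the imaginary units: \<open>J x\<close> plays the role of \<open>i_x\<close>, and
  \<open>q'\<close> below is \<open>q\<close> rotated to the plane of \<open>i_w\<close>.\<close>

definition bergman_kernel :: "(quat \<Rightarrow> quat) \<Rightarrow> real \<Rightarrow> quat \<Rightarrow> quat \<Rightarrow> quat" where
  "bergman_kernel J \<alpha> q w =
     (let q' = of_real (qRe q) + J w * of_real (im_norm q) in
        (1/2) * (1 - J q * J w) * (1 / slice_powr (J w) (1 - q' * qcnj w) (2 + \<alpha>))
      + (1/2) * (1 + J q * J w) * (1 / slice_powr (J w) (1 - qcnj q' * qcnj w) (2 + \<alpha>)))"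

end

theory Submission
  imports Defs "HOL-Complex_Analysis.Complex_Analysis"
begin

text \<open>On a disc with a rotation invariant weight the monomials are orthogonal, and the moments
  of \<open>(\<alpha> + 1) / \<pi> * (1 - |z|\<^sup>2) powr \<alpha>\<close> are the Beta values
  \<open>n! / (\<alpha> + 2)\<^sub>n\<close>, the reciprocals of the binomial coefficients of
  \<open>(1 - x) powr (- (2 + \<alpha>))\<close>; this gives the complex reproducing formula.  On the slice of
  \<open>i\<close>, a slice hyperholomorphic function is holomorphic for left multiplication by \<open>i\<close>, so
  the formula extends to it coordinatewise.  Since \<open>1 - j * i\<close> and \<open>1 + j * i\<close> intertwine
  the planes of \<open>i\<close> and \<open>j = i_w\<close>, the conjugate of \<open>K_w\<close> on the slice of \<open>i\<close> is
  \<open>1/2 * (1 - j * i) * k(\<omega>, \<cdot>) + 1/2 * (1 + j * i) * k(cnj \<omega>, \<cdot>)\<close>, with \<open>k\<close> the kernel of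
  the slice of \<open>i\<close>.  Integrating against \<open>f\<close> yields the representation formula for \<open>f w\<close>
  from its values at the two points of that slice over \<open>w\<close>.\<close>

section \<open>Weighted measure on the disc\<close>

text \<open>Fubini and translation invariance show that the image measure is proportional to Lebesgue
  measure; the unit ball, which is invariant, fixes the factor.\<close>

lemma distr_lborel_orthogonal:
  fixes T :: "'a::euclidean_space \<Rightarrow> 'a"
  assumes T: "orthogonal_transformation T"
  shows "distr lborel borel T = lborel"
proof (rule measure_eqI)
  have lin: "linear T" using T by (rule orthogonal_transformation_linear)
  have nT: "norm (T x) = norm x" for x using T by (rule orthogonal_transformation_norm)
  have Tm [measurable]: "T \<in> borel_measurable borel"
    by (intro borel_measurable_continuous_onI linear_continuous_on linear_conv_bounded_linear[THEN iffD1] lin)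
  have surj: "surj T" using T by (rule orthogonal_transformation_surj)
  define S where "S = inv T"
  have TS: "T (S y) = y" for y unfolding S_def by (simp add: surj surj_f_inv_f)
  fix A assume "A \<in> sets (distr lborel borel T)"
  then have A [measurable]: "A \<in> sets borel" by simp
  define B where "B = ball (0::'a) 1"
  have B [measurable]: "B \<in> sets borel" by (simp add: B_def)
  have transl: "(\<integral>\<^sup>+x. g (x + c) \<partial>lborel) = (\<integral>\<^sup>+x. g x \<partial>lborel)"
    if [measurable]: "g \<in> borel_measurable borel" for g :: "'a \<Rightarrow> ennreal" and c
    by (subst (2) lborel_distr_plus[of c, symmetric]) (simp add: nn_integral_distr add.commute)
  have refl: "(\<integral>\<^sup>+x. g (c - x) \<partial>lborel) = (\<integral>\<^sup>+x. g x \<partial>lborel)"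
    if [measurable]: "g \<in> borel_measurable borel" for g :: "'a \<Rightarrow> ennreal" and c
    by (subst (2) lborel_affine[of "-1" c]) (simp_all add: nn_integral_distr nn_integral_density)
  \<comment> \<open>Both products are evaluations of the double integral of 1_B(y) 1_A(T x + y).
    Shifting x by \<open>S y\<close> removes y from the second factor; shifting y by
    \<open>T x\<close> and reflecting x leaves the volume of \<open>B\<close> as inner
    integral.\<close>
  have "emeasure lborel B * emeasure lborel (T -` A) =
      (\<integral>\<^sup>+y. indicator B y * (\<integral>\<^sup>+x. indicator A (T x) \<partial>lborel) \<partial>lborel)"
  proof -
    have [measurable]: "T -` A \<in> sets borel" using measurable_sets[OF Tm A] by simp
    have "(\<integral>\<^sup>+x. indicator A (T x) \<partial>lborel) = (\<integral>\<^sup>+x. indicator (T -` A) x \<partial>(lborel::'a measure))"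
      by (intro nn_integral_cong) (auto simp: indicator_def)
    then show ?thesis by (simp add: nn_integral_multc)
  qed
  also have "\<dots> = (\<integral>\<^sup>+y. (\<integral>\<^sup>+x. indicator B y * indicator A (T x + y) \<partial>lborel) \<partial>lborel)"
  proof (rule nn_integral_cong)
    fix y
    have "(\<integral>\<^sup>+x. indicator A (T x + y) \<partial>lborel) = (\<integral>\<^sup>+x. indicator A (T (x + S y)) \<partial>(lborel::'a measure))"
      using lin by (simp add: linear_add TS)
    also have "\<dots> = (\<integral>\<^sup>+x. indicator A (T x) \<partial>(lborel::'a measure))"
      by (rule transl) measurable
    finally show "indicator B y * (\<integral>\<^sup>+x. indicator A (T x) \<partial>lborel) =
        (\<integral>\<^sup>+x. indicator B y * indicator A (T x + y) \<partial>lborel)"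
      by (simp add: nn_integral_cmult)
  qed
  also have "\<dots> = (\<integral>\<^sup>+x. (\<integral>\<^sup>+y. indicator B y * indicator A (T x + y) \<partial>lborel) \<partial>lborel)"
    by (rule lborel_pair.Fubini') measurable
  also have "\<dots> = (\<integral>\<^sup>+x. (\<integral>\<^sup>+y. indicator B (y - T x) * indicator A y \<partial>lborel) \<partial>lborel)"
  proof (rule nn_integral_cong)
    fix x
    show "(\<integral>\<^sup>+y. indicator B y * indicator A (T x + y) \<partial>lborel) =
        (\<integral>\<^sup>+y. indicator B (y - T x) * indicator A y \<partial>lborel)"
      using transl[of "\<lambda>y. indicator B (y - T x) * indicator A y" "T x"] by (simp add: add.commute)
  qed
  also have "\<dots> = (\<integral>\<^sup>+y. (\<integral>\<^sup>+x. indicator B (y - T x) * indicator A y \<partial>lborel) \<partial>lborel)"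
    by (rule lborel_pair.Fubini') measurable
  also have "\<dots> = (\<integral>\<^sup>+y. emeasure lborel B * indicator A y \<partial>lborel)"
  proof (rule nn_integral_cong)
    fix y
    have eq: "y - T x = T (S y - x)" for x using lin by (simp add: linear_diff TS)
    have "indicator B (T u) = (indicator B u :: ennreal)" for u by (simp add: B_def indicator_def nT)
    then have "(\<integral>\<^sup>+x. indicator B (y - T x) \<partial>lborel) = (\<integral>\<^sup>+x. indicator B (S y - x) \<partial>(lborel::'a measure))"
      unfolding eq by simp
    also have "\<dots> = emeasure lborel B" by (subst refl) simp_all
    finally show "(\<integral>\<^sup>+x. indicator B (y - T x) * indicator A y \<partial>lborel) = emeasure lborel B * indicator A y"
      by (simp add: nn_integral_multc)
  qed
  also have "\<dots> = emeasure lborel B * emeasure lborel A" by (simp add: nn_integral_cmult)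
  finally have "emeasure lborel B * emeasure lborel (T -` A) = emeasure lborel B * emeasure lborel A" .
  moreover have "unit_ball_vol (real DIM('a)) \<noteq> 0"
    by (metis less_irrefl of_nat_0_le_iff unit_ball_vol_pos)
  then have "emeasure lborel B \<noteq> 0" "emeasure lborel B \<noteq> \<infinity>"
    using emeasure_lborel_ball_finite[of "0::'a" 1] unfolding B_def
    by (simp_all add: emeasure_ball less_top)
  ultimately have "emeasure lborel (T -` A) = emeasure lborel A"
    by (simp add: ennreal_mult_cancel_left)
  then show "emeasure (distr lborel borel T) A = emeasure lborel A"
    by (simp add: emeasure_distr)
qed simp

section \<open>The weighted area measure on the complex disc and its rotation invariance\<close>

text \<open>Restricting the space to the open disc makes \<open>norm z < 1\<close> available in
  every pointwise argument under the integral and lets continuity on the disc give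
  measurability.\<close>

definition disc_measure :: "real \<Rightarrow> complex measure" where
  "disc_measure \<alpha> = restrict_space
     (density lborel (\<lambda>z. ennreal ((\<alpha> + 1) / pi * (1 - (norm z)\<^sup>2) powr \<alpha>))) (ball 0 1)"

lemma space_disc_measure [simp]: "space (disc_measure \<alpha>) = ball 0 1"
  by (simp add: disc_measure_def space_restrict_space)

lemma sets_disc_measure: "sets (disc_measure \<alpha>) = sets (restrict_space borel (ball 0 1))"
  by (simp add: disc_measure_def sets_restrict_space)

lemma continuous_on_measurable_disc [measurable (raw)]:
  assumes "continuous_on (ball 0 1) f"
  shows "f \<in> borel_measurable (disc_measure \<alpha>)"
  using borel_measurable_continuous_on_restrict[OF assms]
  by (simp add: measurable_cong_sets[OF sets_disc_measure refl])

lemma borel_measurable_disc_iff: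
  fixes f :: "complex \<Rightarrow> 'b::{banach, second_countable_topology}"
  shows "f \<in> borel_measurable (disc_measure \<alpha>) \<longleftrightarrow>
    (\<lambda>z. indicator (ball 0 1) z *\<^sub>R f z) \<in> borel_measurable borel"
  using borel_measurable_restrict_space_iff[of "ball 0 1" borel f]
  by (simp add: measurable_cong_sets[OF sets_disc_measure refl])

lemma integral_disc_measure:
  fixes f :: "complex \<Rightarrow> 'b::{banach, second_countable_topology}"
  assumes "\<alpha> > -1" "f \<in> borel_measurable (disc_measure \<alpha>)"
  shows "(LINT z|disc_measure \<alpha>. f z) =
    (LINT z|lborel. ((\<alpha> + 1) / pi * (1 - (norm z)\<^sup>2) powr \<alpha>) *\<^sub>R indicator (ball 0 1) z *\<^sub>R f z)"
  using assms unfolding borel_measurable_disc_iff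
  by (simp add: disc_measure_def integral_restrict_space integral_density)

lemma nn_integral_disc_measure:
  assumes "f \<in> borel_measurable (disc_measure \<alpha>)"
  shows "(\<integral>\<^sup>+z. f z \<partial>disc_measure \<alpha>) =
    (\<integral>\<^sup>+z. ennreal ((\<alpha> + 1) / pi * (1 - (norm z)\<^sup>2) powr \<alpha>) * (f z * indicator (ball 0 1) z) \<partial>lborel)"
proof -
  have "(\<lambda>z. f z * indicator (ball 0 1) z) \<in> borel_measurable borel"
    using assms borel_measurable_restrict_space_iff_ennreal[of "ball 0 1" borel f]
    by (simp add: measurable_cong_sets[OF sets_disc_measure refl])
  then show ?thesis
    by (simp add: disc_measure_def nn_integral_restrict_space nn_integral_density)
qed

text \<open>Multiplication by a unimodular number is an orthogonal map, so it preserves Lebesgue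
  measure; the weight and the disc depend on |z| only.\<close>

lemma integral_disc_measure_rotate:
  fixes f :: "complex \<Rightarrow> 'b::{banach, second_countable_topology}"
  assumes \<alpha>: "\<alpha> > -1" and f: "f \<in> borel_measurable (disc_measure \<alpha>)" and \<zeta>: "norm \<zeta> = 1"
  shows "(LINT z|disc_measure \<alpha>. f (\<zeta> * z)) = (LINT z|disc_measure \<alpha>. f z)"
proof -
  define g where "g z = ((\<alpha> + 1) / pi * (1 - (norm z)\<^sup>2) powr \<alpha>) *\<^sub>R indicator (ball 0 1) z *\<^sub>R f z" for z
  have T: "orthogonal_transformation ((*) \<zeta>)"
    using \<zeta> by (auto simp: orthogonal_transformation norm_mult linear_times)
  have [measurable]: "(\<lambda>z. indicator (ball 0 1) z *\<^sub>R f z) \<in> borel_measurable borel"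
    using f by (simp add: borel_measurable_disc_iff)
  have [measurable]: "(*) \<zeta> \<in> borel_measurable borel"
    by (intro borel_measurable_continuous_onI continuous_intros)
  have [measurable]: "g \<in> borel_measurable borel" unfolding g_def by measurable
  have m: "(\<lambda>z. indicator (ball 0 1) (\<zeta> * z) *\<^sub>R f (\<zeta> * z)) \<in> borel_measurable borel"
    by measurable
  have "(indicator (ball 0 1) (\<zeta> * z) :: real) = indicator (ball 0 1) z" for z
    using \<zeta> by (simp add: indicator_def norm_mult)
  with m have "(\<lambda>z. f (\<zeta> * z)) \<in> borel_measurable (disc_measure \<alpha>)"
    by (simp add: borel_measurable_disc_iff)
  then have "(LINT z|disc_measure \<alpha>. f (\<zeta> * z)) = (LINT z|lborel. g (\<zeta> * z))"
    using \<zeta> \<alpha> by (simp add: integral_disc_measure g_def norm_mult indicator_def)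
  also have "\<dots> = (LINT z|distr lborel borel ((*) \<zeta>). g z)"
    by (subst integral_distr) simp_all
  also have "\<dots> = (LINT z|disc_measure \<alpha>. f z)"
    using \<alpha> f by (simp add: distr_lborel_orthogonal[OF T] integral_disc_measure g_def)
  finally show ?thesis .
qed

section \<open>Radial integrals, moments and binomial coefficients\<close>

text \<open>The image of area on the disc under the squared modulus is pi times length on [0,1),
  because the annulus x < |z|^2 < 1 has area pi (1 - x). The two measures are finite and equal on
  all half-lines, hence equal.\<close>

lemma nn_integral_disc_radial:
  fixes \<phi> :: "real \<Rightarrow> ennreal"
  assumes [measurable]: "\<phi> \<in> borel_measurable borel"
  shows "(\<integral>\<^sup>+z. \<phi> ((norm z)\<^sup>2) * indicator (ball 0 1) z \<partial>(lborel :: complex measure)) =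
    (\<integral>\<^sup>+t. ennreal pi * (\<phi> t * indicator {0..<1} t) \<partial>lborel)"
proof -
  define M where "M = distr (restrict_space lborel (ball (0::complex) 1)) borel (\<lambda>z. (norm z)\<^sup>2)"
  have nm: "(\<lambda>z. (norm z)\<^sup>2) \<in> restrict_space lborel (ball (0::complex) 1) \<rightarrow>\<^sub>M (borel :: real measure)"
    by (intro measurable_restrict_space1) measurable
  define N where "N = density lborel (\<lambda>t::real. ennreal pi * indicator {0..<1} t)"
  have M: "emeasure M {x<..} = emeasure lborel (ball (0::complex) 1 \<inter> {z. x < (norm z)\<^sup>2})" for x
  proof -
    have "(\<lambda>z. (norm z)\<^sup>2) -` {x<..} \<inter> ball 0 1 = ball (0::complex) 1 \<inter> {z. x < (norm z)\<^sup>2}" by auto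
    then show ?thesis
      unfolding M_def by (simp add: emeasure_distr[OF nm] emeasure_restrict_space space_restrict_space)
  qed
  have N: "emeasure N {x<..} = ennreal pi * emeasure lborel ({0..<1} \<inter> {x<..})" for x
    unfolding N_def by (simp add: emeasure_density mult.assoc nn_integral_cmult indicator_inter_arith[symmetric])
  have "M = N"
  proof (rule measure_eqI_lessThan)
    show "emeasure M {x<..} = emeasure N {x<..}" for x :: real
    proof -
      consider "x < 0" | "0 \<le> x" "x < 1" | "1 \<le> x" by linarith
      then show ?thesis
      proof cases
        case 1
        then have "x < (norm z)\<^sup>2" for z :: complex
          using zero_le_power2[of "norm z"] by linarith
        then have e: "ball (0::complex) 1 \<inter> {z. x < (norm z)\<^sup>2} = ball 0 1" by blast
        have e': "{0..<1} \<inter> {x<..} = {0..<1}" using 1 by auto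
        show ?thesis unfolding M N e e' by (simp add: emeasure_ball eval_unit_ball_vol)
      next
        case 2
        have "x < (norm z)\<^sup>2 \<longleftrightarrow> sqrt x < norm z" for z :: complex
          using real_sqrt_less_iff[of x "(norm z)\<^sup>2"] unfolding real_sqrt_abs abs_norm_cancel by (rule sym)
        then have e: "ball (0::complex) 1 \<inter> {z. x < (norm z)\<^sup>2} = ball 0 1 - cball 0 (sqrt x)"
          unfolding set_eq_iff Int_iff Diff_iff mem_Collect_eq mem_cball_0 mem_ball_0 not_le by blast
        have e': "{0..<1} \<inter> {x<..} = {x<..<1}" using 2 by auto
        have sub: "cball 0 (sqrt x) \<subseteq> ball (0::complex) 1"
        proof
          fix z :: complex assume "z \<in> cball 0 (sqrt x)"
          moreover have "sqrt x < 1" using 2 by simp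
          ultimately show "z \<in> ball 0 1" unfolding mem_cball_0 mem_ball_0 by (rule le_less_trans)
        qed
        have fin: "emeasure lborel (cball (0::complex) (sqrt x)) \<noteq> \<infinity>"
          using emeasure_lborel_cball_finite[of "0::complex" "sqrt x"] by (rule less_imp_neq)
        have "emeasure lborel (ball (0::complex) 1 - cball 0 (sqrt x)) =
            emeasure lborel (ball (0::complex) 1) - emeasure lborel (cball (0::complex) (sqrt x))"
          by (rule emeasure_Diff[OF fin _ _ sub]) simp_all
        also have "\<dots> = ennreal pi - ennreal (pi * x)"
          using 2 by (simp add: emeasure_ball emeasure_cball eval_unit_ball_vol)
        also have "\<dots> = ennreal pi * ennreal (1 - x)"
          using 2 by (simp add: ennreal_minus ennreal_mult[symmetric] right_diff_distrib)
        finally show ?thesis unfolding M N e e' using 2 by simp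
      next
        case 3
        have "(norm z)\<^sup>2 \<le> x" if "norm z < 1" for z :: complex
          using 3 that power_le_one[of "norm z" 2] by simp
        then have e: "ball (0::complex) 1 \<inter> {z. x < (norm z)\<^sup>2} = {}"
          unfolding disjoint_iff mem_ball_0 mem_Collect_eq not_less by blast
        have e': "{0..<1} \<inter> {x<..} = {}" using 3 by auto
        show ?thesis unfolding M N e e' by simp
      qed
    qed
    show "emeasure M {x<..} < \<infinity>" for x
    proof -
      have "emeasure M {x<..} \<le> emeasure lborel (ball (0::complex) 1)"
        unfolding M by (intro emeasure_mono) auto
      also have "\<dots> < \<infinity>" by (rule emeasure_lborel_ball_finite)
      finally show ?thesis .
    qed
  qed (simp_all add: M_def N_def)
  have "(\<integral>\<^sup>+z. \<phi> ((norm z)\<^sup>2) * indicator (ball 0 1) z \<partial>(lborel :: complex measure)) = (\<integral>\<^sup>+t. \<phi> t \<partial>M)"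
    unfolding M_def by (simp add: nn_integral_distr[OF nm] nn_integral_restrict_space)
  also have "\<dots> = (\<integral>\<^sup>+t. ennreal pi * (\<phi> t * indicator {0..<1} t) \<partial>lborel)"
    unfolding \<open>M = N\<close> N_def by (simp add: nn_integral_density mult_ac)
  finally show ?thesis .
qed

text \<open>The integral of |z|^(2n) against \<open>disc_measure \<alpha>\<close>: the substitution
  t = |z|^2 turns it into a Beta integral.\<close>

definition disc_moment :: "real \<Rightarrow> nat \<Rightarrow> real" where
  "disc_moment \<alpha> n = (\<alpha> + 1) * Beta (real n + 1) (\<alpha> + 1)"

lemma disc_moment_nonneg: "\<alpha> > -1 \<Longrightarrow> disc_moment \<alpha> n \<ge> 0"
  by (simp add: disc_moment_def Beta_def Gamma_real_nonneg)

lemma nn_integral_disc_power: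
  assumes \<alpha>: "\<alpha> > -1"
  shows "(\<integral>\<^sup>+z. ennreal (norm z ^ (2 * n)) \<partial>disc_measure \<alpha>) = ennreal (disc_moment \<alpha> n)"
proof -
  define \<phi> where "\<phi> t = ennreal ((\<alpha> + 1) / pi * (1 - t) powr \<alpha> * t ^ n)" for t
  have [measurable]: "\<phi> \<in> borel_measurable borel" unfolding \<phi>_def by measurable
  have "(\<integral>\<^sup>+z. ennreal (norm z ^ (2 * n)) \<partial>disc_measure \<alpha>) =
      (\<integral>\<^sup>+z. \<phi> ((norm z)\<^sup>2) * indicator (ball 0 1) z \<partial>(lborel::complex measure))"
  proof -
    have "(\<lambda>z. norm z ^ (2 * n)) \<in> borel_measurable (disc_measure \<alpha>)"
      by (intro continuous_on_measurable_disc continuous_intros)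
    moreover have "norm z ^ (2 * n) = ((norm z)\<^sup>2) ^ n" for z :: complex by (rule power_mult)
    ultimately show ?thesis
      using \<alpha> by (subst nn_integral_disc_measure) (auto simp: \<phi>_def ennreal_mult'[symmetric] mult_ac)
  qed
  also have "\<dots> = (\<integral>\<^sup>+t. ennreal pi * (\<phi> t * indicator {0..<1} t) \<partial>lborel)"
    by (rule nn_integral_disc_radial) measurable
  also have "\<dots> = (\<integral>\<^sup>+t. ennreal (\<alpha> + 1) * ennreal (indicator {0..1} t * (t powr (real n + 1 - 1) * (1 - t) powr (\<alpha> + 1 - 1))) \<partial>lborel)"
  proof (rule nn_integral_cong_AE)
    \<comment> \<open>For n = 0 the point t = 0 separates \<open>0 ^ 0 = 1\<close> from
      \<open>0 powr 0 = 0\<close>, and at t = 1 the two indicators differ; both points are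
      null.\<close>
    have "AE t in lborel. t \<noteq> 0 \<and> t \<noteq> (1::real)"
      using AE_lborel_singleton[of "0::real"] AE_lborel_singleton[of "1::real"] by eventually_elim auto
    then show "AE t in lborel. ennreal pi * (\<phi> t * indicator {0..<1} t) =
        ennreal (\<alpha> + 1) * ennreal (indicator {0..1} t * (t powr (real n + 1 - 1) * (1 - t) powr (\<alpha> + 1 - 1)))"
    proof eventually_elim
      case (elim t)
      then show ?case using \<alpha>
        by (auto simp: \<phi>_def indicator_def powr_realpow ennreal_mult[symmetric] mult_ac)
    qed
  qed
  also have "\<dots> = ennreal (\<alpha> + 1) * ennreal (Beta (real n + 1) (\<alpha> + 1))"
  proof -
    have "(\<integral>\<^sup>+t. ennreal (indicator {0..1} t * (t powr (real n + 1 - 1) * (1 - t) powr (\<alpha> + 1 - 1))) \<partial>lborel) =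
        ennreal (Beta (real n + 1) (\<alpha> + 1))"
      using \<alpha> by (intro nn_integral_has_integral_lebesgue has_integral_Beta_real) auto
    then show ?thesis by (subst nn_integral_cmult) simp_all
  qed
  finally show ?thesis using \<alpha> by (simp add: disc_moment_def ennreal_mult'[symmetric])
qed

lemma integrable_disc_power:
  assumes \<alpha>: "\<alpha> > -1"
  shows "integrable (disc_measure \<alpha>) (\<lambda>z. norm z ^ (2 * n))"
    and integral_disc_power: "(LINT z|disc_measure \<alpha>. norm z ^ (2 * n)) = disc_moment \<alpha> n"
proof -
  have "(\<lambda>z. norm z ^ (2 * n)) \<in> borel_measurable (disc_measure \<alpha>)"
    by (intro continuous_on_measurable_disc continuous_intros)
  then have "integrable (disc_measure \<alpha>) (\<lambda>z. norm z ^ (2 * n)) \<and>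
      (LINT z|disc_measure \<alpha>. norm z ^ (2 * n)) = disc_moment \<alpha> n"
    using nn_integral_disc_power[OF \<alpha>, of n] disc_moment_nonneg[OF \<alpha>, of n]
    by (subst (asm) nn_integral_eq_integrable) auto
  then show "integrable (disc_measure \<alpha>) (\<lambda>z. norm z ^ (2 * n))"
    "(LINT z|disc_measure \<alpha>. norm z ^ (2 * n)) = disc_moment \<alpha> n" by auto
qed

lemma finite_measure_disc: "\<alpha> > -1 \<Longrightarrow> finite_measure (disc_measure \<alpha>)"
  using nn_integral_disc_power[of \<alpha> 0] by (intro finite_measureI) simp

text \<open>In Pochhammer symbols the moment is n! / (\<alpha> + 2)_n, and the signed binomial
  coefficient is the reciprocal (\<alpha> + 2)_n / n!.\<close>

lemma binomial_disc_moment: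
  assumes \<alpha>: "\<alpha> > -1"
  shows "(-1) ^ n * (complex_of_real (- (2 + \<alpha>)) gchoose n) * of_real (disc_moment \<alpha> n) = 1"
proof -
  have g: "Gamma (\<alpha> + 2 + real n) = pochhammer (\<alpha> + 2) n * Gamma (\<alpha> + 2)"
    (is "?l = ?r")
  proof -
    have "\<alpha> + 2 \<notin> \<int>\<^sub>\<le>\<^sub>0" using \<alpha> nonpos_Ints_nonpos[of "\<alpha> + 2"] by auto
    then show ?thesis
      using pochhammer_Gamma[of "\<alpha> + 2" n] by (simp add: field_simps Gamma_eq_zero_iff)
  qed
  have p: "pochhammer (\<alpha> + 2) n > 0" using \<alpha> by (intro pochhammer_pos) auto
  \<comment> \<open>The functional equation absorbs the normalising factor \<alpha> + 1 of the
    measure, so that the Gamma factors cancel.\<close>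
  have g2: "Gamma (\<alpha> + 2) = (\<alpha> + 1) * Gamma (\<alpha> + 1)"
  proof -
    have "\<alpha> + 1 \<notin> \<int>\<^sub>\<le>\<^sub>0" using \<alpha> nonpos_Ints_nonpos[of "\<alpha> + 1"] by auto
    from Gamma_plus1[OF this] show ?thesis by (simp add: add.assoc)
  qed
  have g1: "Gamma (\<alpha> + 1) > 0" using \<alpha> by (intro Gamma_real_pos) auto
  have "disc_moment \<alpha> n = fact n * ((\<alpha> + 1) * Gamma (\<alpha> + 1)) / Gamma (\<alpha> + 2 + real n)"
    using Gamma_fact[of n, where 'a=real]
    by (simp add: disc_moment_def Beta_def add_ac)
  also have "\<dots> = fact n / pochhammer (\<alpha> + 2) n"
  proof -
    have "(\<alpha> + 1) * Gamma (\<alpha> + 1) \<noteq> 0" using mult_pos_pos[of "\<alpha>+1", OF _ g1] \<alpha> by linarith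
    then show ?thesis unfolding g g2 by (rule nonzero_mult_divide_mult_cancel_right)
  qed
  finally have m: "disc_moment \<alpha> n = fact n / pochhammer (\<alpha> + 2) n" .
  have "(-1) ^ n * (complex_of_real (- (2 + \<alpha>)) gchoose n) = pochhammer (of_real (\<alpha> + 2)) n / fact n"
    by (simp add: gbinomial_pochhammer power_mult_distrib[symmetric] add.commute)
  also have "\<dots> = of_real (pochhammer (\<alpha> + 2) n / fact n)"
    by (simp only: pochhammer_of_real of_real_divide of_real_fact)
  finally show ?thesis using p by (simp add: m of_real_divide of_real_mult[symmetric] del: of_real_mult)
qed

section \<open>The reproducing kernel of the disc\<close>

lemma integrable_disc_bounded:
  fixes f :: "complex \<Rightarrow> 'b::{banach, second_countable_topology}"
  assumes "\<alpha> > -1" "f \<in> borel_measurable (disc_measure \<alpha>)" "\<And>z. norm z < 1 \<Longrightarrow> norm (f z) \<le> B"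
  shows "integrable (disc_measure \<alpha>) f"
  using assms by (intro finite_measure.integrable_const_bound[OF finite_measure_disc, of _ _ B]) auto

lemma measurable_indicator_ball_disc [measurable]:
  "(indicator (ball 0 r) :: complex \<Rightarrow> real) \<in> borel_measurable (disc_measure \<alpha>)"
proof -
  have "(indicator (ball 0 r) :: complex \<Rightarrow> real) \<in> borel_measurable (restrict_space borel (ball 0 1))"
    by (intro measurable_restrict_space1 borel_measurable_indicator) simp
  then show ?thesis by (simp add: measurable_cong_sets[OF sets_disc_measure refl])
qed

lemma measurable_cnj_power_mult_disc [measurable]:
  "(\<lambda>z. cnj z ^ n * z ^ m) \<in> borel_measurable (disc_measure \<alpha>)"
  by (intro continuous_on_measurable_disc continuous_intros)

text \<open>A rotation that changes the sign of the integrand makes the integral equal to its own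
  negative. The cutoff ball is rotation invariant as well.\<close>

lemma integral_disc_orthogonal:
  assumes \<alpha>: "\<alpha> > -1" and "m \<noteq> n"
  shows "(LINT z|disc_measure \<alpha>. indicator (ball 0 r) z *\<^sub>R (cnj z ^ n * z ^ m)) = 0"
proof -
  \<comment> \<open>The angle is chosen so that \<zeta>^(m - n) = cis pi = -1; the real quotient
    covers m < n too.\<close>
  define \<zeta> where "\<zeta> = cis (pi / (real m - real n))"
  have pow: "cnj (cis t) ^ n * cis t ^ m = cis (real m * t - real n * t)" for t
    unfolding cis_cnj Complex.DeMoivre cis_mult by (simp add: algebra_simps)
  have "cnj \<zeta> ^ n * \<zeta> ^ m = cis (real m * (pi / (real m - real n)) - real n * (pi / (real m - real n)))"
    unfolding \<zeta>_def by (rule pow)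
  also have "real m * (pi / (real m - real n)) - real n * (pi / (real m - real n)) = pi"
    using \<open>m \<noteq> n\<close> unfolding left_diff_distrib[symmetric] by simp
  finally have *: "cnj \<zeta> ^ n * \<zeta> ^ m = -1" by simp
  define f where "f z = indicator (ball 0 r) z *\<^sub>R (cnj z ^ n * z ^ m)" for z
  have "f (\<zeta> * z) = - f z" for z
  proof -
    have "f (\<zeta> * z) = indicator (ball 0 r) z *\<^sub>R ((cnj \<zeta> ^ n * \<zeta> ^ m) * (cnj z ^ n * z ^ m))"
      by (simp add: f_def indicator_def norm_mult \<zeta>_def power_mult_distrib mult_ac)
    then show ?thesis unfolding * by (simp add: f_def)
  qed
  moreover have "f \<in> borel_measurable (disc_measure \<alpha>)" unfolding f_def by measurable
  then have "(LINT z|disc_measure \<alpha>. f (\<zeta> * z)) = (LINT z|disc_measure \<alpha>. f z)"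
    using \<alpha> by (intro integral_disc_measure_rotate) (simp_all add: \<zeta>_def)
  ultimately show ?thesis by (simp add: f_def)
qed

text \<open>On |z| < r < 1 the power series is dominated by a convergent numerical series, so it can
  be integrated term by term, and orthogonality leaves the n-th term alone. The cutoff avoids the
  boundary, where such domination may fail.\<close>

lemma integral_disc_cnj_power_cutoff:
  fixes h :: "complex \<Rightarrow> complex" and a :: "nat \<Rightarrow> complex"
  assumes \<alpha>: "\<alpha> > -1" and r: "0 < r" "r < 1"
    and sums: "\<And>z. norm z < 1 \<Longrightarrow> (\<lambda>m. a m * z ^ m) sums h z"
  shows "(LINT z|disc_measure \<alpha>. indicator (ball 0 r) z *\<^sub>R (cnj z ^ n * h z)) =
    a n * of_real (LINT z|disc_measure \<alpha>. indicator (ball 0 r) z *\<^sub>R norm z ^ (2 * n))"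
proof -
  let ?M = "disc_measure \<alpha>"
  define f where "f m z = indicator (ball 0 r) z *\<^sub>R (cnj z ^ n * (a m * z ^ m))" for m z
  have f_eq: "f m z = a m * (indicator (ball 0 r) z *\<^sub>R (cnj z ^ n * z ^ m))" for m z
    by (simp add: f_def)
  have nf: "norm (f m z) \<le> norm (a m * of_real r ^ m)" if "norm z < 1" for m z
  proof -
    have "norm z ^ n * norm z ^ m \<le> 1 * r ^ m" if "norm z < r"
      using that \<open>norm z < 1\<close> by (intro mult_mono power_mono power_le_one) auto
    then show ?thesis
      using r by (auto simp: f_eq indicator_def norm_mult norm_power intro!: mult_left_mono)
  qed
  \<comment> \<open>Convergence at (1 + r) / 2, strictly between r and 1, gives absolute convergence
    at r.\<close>
  have sr: "summable (\<lambda>m. norm (a m * of_real r ^ m))"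
    using sums[of "of_real ((1 + r) / 2)"] r
    by (intro powser_insidea[of _ "of_real ((1 + r) / 2)"]) (auto simp: sums_iff simp del: of_real_divide of_real_add)
  have [measurable]: "f m \<in> borel_measurable ?M" for m unfolding f_eq[abs_def] by measurable
  have int: "integrable ?M (f m)" for m
    using \<alpha> nf by (intro integrable_disc_bounded) auto
  have "(\<lambda>m. integral\<^sup>L ?M (f m)) sums (LINT z|?M. (\<Sum>m. f m z))"
  proof (rule sums_integral[OF int])
    show "AE z in ?M. summable (\<lambda>m. norm (f m z))"
      by (intro AE_I2 summable_comparison_test'[OF sr, of 0]) (auto intro: nf)
    have fin: "finite_measure ?M" using \<alpha> by (rule finite_measure_disc)
    have "norm (LINT z|?M. norm (f m z)) \<le> norm (a m * of_real r ^ m) * measure ?M (ball 0 1)" for m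
    proof -
      have "(LINT z|?M. norm (f m z)) \<le> (LINT z|?M. norm (a m * of_real r ^ m))"
        using nf by (intro integral_mono integrable_norm int finite_measure.integrable_const[OF fin]) auto
      then show ?thesis by (simp add: mult.commute)
    qed
    then show "summable (\<lambda>m. LINT z|?M. norm (f m z))"
      by (intro summable_comparison_test'[OF summable_mult2[OF sr], of 0])
  qed
  moreover have "(LINT z|?M. (\<Sum>m. f m z)) = (LINT z|?M. indicator (ball 0 r) z *\<^sub>R (cnj z ^ n * h z))"
  proof (rule Bochner_Integration.integral_cong[OF refl])
    fix z assume "z \<in> space ?M"
    then have "(\<lambda>m. f m z) sums (indicator (ball 0 r) z *\<^sub>R (cnj z ^ n * h z))"
      unfolding f_def by (intro sums_scaleR_right sums_mult sums) simp
    then show "(\<Sum>m. f m z) = indicator (ball 0 r) z *\<^sub>R (cnj z ^ n * h z)" by (simp add: sums_iff)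
  qed
  moreover have "integral\<^sup>L ?M (f m) =
      (if m = n then a n * of_real (LINT z|?M. indicator (ball 0 r) z *\<^sub>R norm z ^ (2 * n)) else 0)" for m
  proof (cases "m = n")
    case True
    have "indicator (ball 0 r) z *\<^sub>R (cnj z ^ n * z ^ n) = complex_of_real (indicator (ball 0 r) z *\<^sub>R norm z ^ (2 * n))" for z
      by (simp add: power_mult_distrib[symmetric] complex_norm_square[symmetric] mult.commute[of "cnj z"] power_mult
          scaleR_conv_of_real)
    then have "integral\<^sup>L ?M (f n) = a n * (LINT z|?M. complex_of_real (indicator (ball 0 r) z *\<^sub>R norm z ^ (2 * n)))"
      unfolding f_eq[abs_def] by (simp only: integral_mult_right_zero)
    then show ?thesis using True by (simp only: integral_complex_of_real if_True simp_thms)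
  next
    case False
    then show ?thesis
      unfolding f_eq[abs_def] integral_mult_right_zero integral_disc_orthogonal[OF \<alpha> False] by simp
  qed
  ultimately show ?thesis using sums_single[of n "\<lambda>_. a n * of_real (LINT z|?M. indicator (ball 0 r) z *\<^sub>R norm z ^ (2 * n))"]
    by (simp add: sums_iff)
qed

text \<open>The cutoff radius tends to 1. Dominated convergence applies on both sides, with bounds
  |h| and |z|^(2n), and the cut-off moment becomes the full one.\<close>

lemma integral_disc_cnj_power:
  fixes h :: "complex \<Rightarrow> complex" and a :: "nat \<Rightarrow> complex"
  assumes \<alpha>: "\<alpha> > -1" and h: "integrable (disc_measure \<alpha>) h"
    and sums: "\<And>z. norm z < 1 \<Longrightarrow> (\<lambda>m. a m * z ^ m) sums h z"
  shows "(LINT z|disc_measure \<alpha>. cnj z ^ n * h z) = a n * of_real (disc_moment \<alpha> n)"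
proof -
  let ?M = "disc_measure \<alpha>"
  \<comment> \<open>The radii are 1 - 1/(k + 2), starting at 1/2, so that none of them is 0.\<close>
  define r where "r k = 1 - inverse (real (Suc (Suc k)))" for k
  have r: "0 < r k" "r k < 1" for k by (auto simp: r_def field_simps)
  have rlim: "r \<longlonglongrightarrow> 1"
    unfolding r_def using LIMSEQ_ignore_initial_segment[OF LIMSEQ_inverse_real_of_nat_add_minus[of 1], of 1] by simp
  have lim: "(\<lambda>k. indicator (ball 0 (r k)) z *\<^sub>R c) \<longlonglongrightarrow> c" if "norm z < 1" for z :: complex and c :: "'c::real_normed_vector"
  proof (rule tendsto_eventually)
    have "eventually (\<lambda>k. norm z < r k) sequentially" using order_tendstoD(1)[OF rlim that] .
    then show "eventually (\<lambda>k. indicator (ball 0 (r k)) z *\<^sub>R c = c) sequentially"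
      by eventually_elim simp
  qed
  have hm [measurable]: "h \<in> borel_measurable ?M" using h by auto
  have [measurable]: "(\<lambda>z. cnj z ^ n) \<in> borel_measurable ?M"
    using measurable_cnj_power_mult_disc[of n 0 \<alpha>] by simp
  have [measurable]: "(\<lambda>z. norm z ^ (2 * n)) \<in> borel_measurable ?M"
    by (intro continuous_on_measurable_disc continuous_intros)
  have "(\<lambda>k. LINT z|?M. indicator (ball 0 (r k)) z *\<^sub>R (cnj z ^ n * h z)) \<longlonglongrightarrow> (LINT z|?M. cnj z ^ n * h z)"
  proof (rule integral_dominated_convergence[where w = "\<lambda>z. norm (h z)"])
    show "AE z in ?M. norm (indicator (ball 0 (r k)) z *\<^sub>R (cnj z ^ n * h z)) \<le> norm (h z)" for k
    proof (rule AE_I2)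
      fix z assume "z \<in> space ?M"
      then have "norm z ^ n * norm (h z) \<le> 1 * norm (h z)" by (intro mult_right_mono power_le_one) auto
      then show "norm (indicator (ball 0 (r k)) z *\<^sub>R (cnj z ^ n * h z)) \<le> norm (h z)"
        by (auto simp: indicator_def norm_mult norm_power)
    qed
    show "AE z in ?M. (\<lambda>k. indicator (ball 0 (r k)) z *\<^sub>R (cnj z ^ n * h z)) \<longlonglongrightarrow> cnj z ^ n * h z"
      by (intro AE_I2 lim) simp
    show "integrable ?M (\<lambda>z. norm (h z))" using h by simp
  qed measurable
  moreover have "(\<lambda>k. LINT z|?M. indicator (ball 0 (r k)) z *\<^sub>R norm z ^ (2 * n)) \<longlonglongrightarrow> (LINT z|?M. norm z ^ (2 * n))"
  proof (rule integral_dominated_convergence[where w = "\<lambda>z. norm z ^ (2 * n)"])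
    show "AE z in ?M. norm (indicator (ball 0 (r k)) z *\<^sub>R norm z ^ (2 * n)) \<le> norm z ^ (2 * n)" for k
      by (intro AE_I2) (auto simp: indicator_def)
    show "AE z in ?M. (\<lambda>k. indicator (ball 0 (r k)) z *\<^sub>R norm z ^ (2 * n)) \<longlonglongrightarrow> norm z ^ (2 * n)"
      by (intro AE_I2 lim) simp
    show "integrable ?M (\<lambda>z. norm z ^ (2 * n))" using \<alpha> by (rule integrable_disc_power)
  qed measurable
  then have "(\<lambda>k. a n * of_real (LINT z|?M. indicator (ball 0 (r k)) z *\<^sub>R norm z ^ (2 * n))) \<longlonglongrightarrow>
      a n * of_real (disc_moment \<alpha> n)"
    unfolding integral_disc_power[OF \<alpha>] by (intro tendsto_intros)
  moreover have "(LINT z|?M. indicator (ball 0 (r k)) z *\<^sub>R (cnj z ^ n * h z)) =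
      a n * of_real (LINT z|?M. indicator (ball 0 (r k)) z *\<^sub>R norm z ^ (2 * n))" for k
    using \<alpha> r[of k] sums by (rule integral_disc_cnj_power_cutoff)
  ultimately show ?thesis by (simp only: LIMSEQ_unique)
qed

text \<open>Expanding the kernel in powers of \<open>\<omega>\<close> turns the integral into the Taylor series of \<open>h\<close>,
  since the binomial coefficients are the reciprocals of the moments.\<close>

theorem disc_reproducing:
  fixes h :: "complex \<Rightarrow> complex"
  assumes \<alpha>: "\<alpha> > -1" and hol: "h holomorphic_on ball 0 1"
    and h: "integrable (disc_measure \<alpha>) h" and \<omega>: "norm \<omega> < 1"
  shows "(LINT z|disc_measure \<alpha>. (1 - \<omega> * cnj z) powr (- of_real (2 + \<alpha>)) * h z) = h \<omega>"
proof -
  let ?M = "disc_measure \<alpha>"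
  define a where "a m = (deriv ^^ m) h 0 / fact m" for m
  have sums: "(\<lambda>m. a m * z ^ m) sums h z" if "norm z < 1" for z
    using holomorphic_power_series[OF hol, of z] that by (simp add: a_def)
  \<comment> \<open>Taylor coefficients of (1 - x) powr (-(2 + \<alpha>)); the sign comes from
    inserting -x into the binomial series.\<close>
  define C where "C n = (-1) ^ n * (complex_of_real (- (2 + \<alpha>)) gchoose n)" for n
  have ker: "(\<lambda>n. C n * x ^ n) sums (1 - x) powr (- of_real (2 + \<alpha>))" if "norm x < 1" for x
    using gen_binomial_complex[of "-x" "- of_real (2 + \<alpha>)"] that
    by (simp add: C_def power_minus[of x] mult_ac)
  define f where "f n z = C n * \<omega> ^ n * (cnj z ^ n * h z)" for n z
  have [measurable]: "h \<in> borel_measurable ?M" "(\<lambda>z. cnj z ^ n) \<in> borel_measurable ?M" for n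
    using h measurable_cnj_power_mult_disc[of n 0 \<alpha>] by auto
  have nf: "norm (f n z) \<le> norm (C n * \<omega> ^ n) * norm (h z)" if "norm z < 1" for n z
  proof -
    have "norm z ^ n * norm (h z) \<le> 1 * norm (h z)" using that by (intro mult_right_mono power_le_one) auto
    then show ?thesis by (simp add: f_def norm_mult norm_power mult_left_mono)
  qed
  have int: "integrable ?M (f n)" for n
  proof (rule Bochner_Integration.integrable_bound)
    show "integrable ?M (\<lambda>z. norm (C n * \<omega> ^ n) * norm (h z))" using h by simp
    show "f n \<in> borel_measurable ?M" unfolding f_def by measurable
    show "AE z in ?M. norm (f n z) \<le> norm (norm (C n * \<omega> ^ n) * norm (h z))"
      using nf by (intro AE_I2) simp
  qed
  \<comment> \<open>The auxiliary point lies strictly between |\<omega>| and 1. The resulting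
    series, times |h z|, bounds the expansion for all |z| < 1, so no cutoff is required
    here.\<close>
  have sC: "summable (\<lambda>n. norm (C n * \<omega> ^ n))"
    using ker[of "of_real ((1 + norm \<omega>) / 2)"] \<omega>
    by (intro powser_insidea[of _ "of_real ((1 + norm \<omega>) / 2)"])
      (auto simp: sums_iff simp del: of_real_divide of_real_add)
  have "(\<lambda>n. integral\<^sup>L ?M (f n)) sums (LINT z|?M. (\<Sum>n. f n z))"
  proof (rule sums_integral[OF int])
    show "AE z in ?M. summable (\<lambda>n. norm (f n z))"
    proof (rule AE_I2)
      fix z assume "z \<in> space ?M"
      then show "summable (\<lambda>n. norm (f n z))"
        by (intro summable_comparison_test'[OF summable_mult2[OF sC, of "norm (h z)"], of 0])
          (auto intro: nf)
    qed
    have "norm (LINT z|?M. norm (f n z)) \<le> norm (C n * \<omega> ^ n) * (LINT z|?M. norm (h z))" for n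
    proof -
      have "(LINT z|?M. norm (f n z)) \<le> (LINT z|?M. norm (C n * \<omega> ^ n) * norm (h z))"
        using nf h by (intro integral_mono integrable_norm int) auto
      then show ?thesis by simp
    qed
    then show "summable (\<lambda>n. LINT z|?M. norm (f n z))"
      by (intro summable_comparison_test'[OF summable_mult2[OF sC], of 0])
  qed
  moreover have "(LINT z|?M. (\<Sum>n. f n z)) =
      (LINT z|?M. (1 - \<omega> * cnj z) powr (- of_real (2 + \<alpha>)) * h z)"
  proof (rule Bochner_Integration.integral_cong[OF refl])
    fix z assume "z \<in> space ?M"
    then have "norm (\<omega> * cnj z) < 1"
      using \<omega> mult_strict_mono'[of "norm \<omega>" 1 "norm z" 1] by (simp add: norm_mult)
    from sums_mult2[OF ker[OF this], of "h z"]
    have "(\<lambda>n. f n z) sums ((1 - \<omega> * cnj z) powr (- of_real (2 + \<alpha>)) * h z)"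
      by (simp add: f_def power_mult_distrib mult_ac)
    then show "(\<Sum>n. f n z) = (1 - \<omega> * cnj z) powr (- of_real (2 + \<alpha>)) * h z"
      by (simp add: sums_iff)
  qed
  moreover have "integral\<^sup>L ?M (f n) = a n * \<omega> ^ n" for n
  proof -
    have "integral\<^sup>L ?M (f n) = C n * \<omega> ^ n * (a n * of_real (disc_moment \<alpha> n))"
      unfolding f_def integral_mult_right_zero using integral_disc_cnj_power[OF \<alpha> h sums, of n] by simp
    also have "\<dots> = (C n * of_real (disc_moment \<alpha> n)) * (a n * \<omega> ^ n)" by (simp add: mult_ac)
    finally show ?thesis unfolding C_def binomial_disc_moment[OF \<alpha>] by simp
  qed
  ultimately show ?thesis using sums[OF \<omega>] by (simp add: sums_iff)
qed

section \<open>Slices and stem functions\<close>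

text \<open>With \<open>scaleR\<close> the real coefficients are visibly central, so noncommutative
  products can be expanded by simplification.\<close>

lemma slice_embed_scaleR: "slice_embed i z = Re z *\<^sub>R 1 + Im z *\<^sub>R i"
  by (simp add: slice_embed_def of_real_def)

lemma im_sphere_mult_self: "i \<in> im_sphere \<Longrightarrow> i * i = -1"
  using quat_norm_sq[of i]
  by (simp add: im_sphere_def quat_eq_iff quat_times_sel power2_eq_square)

lemma im_sphere_uminus: "i \<in> im_sphere \<Longrightarrow> - i \<in> im_sphere"
  by (simp add: im_sphere_def)

lemma im_sphere_mult_mult: "i \<in> im_sphere \<Longrightarrow> i * (i * x) = - x"
  by (simp add: mult.assoc[symmetric] im_sphere_mult_self)

text \<open>Since \<open>i * i = -1\<close>, the embedding is a homomorphism of real algebras;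
  computations inside one slice can be done with complex numbers.\<close>

lemma slice_embed_mult:
  "i \<in> im_sphere \<Longrightarrow> slice_embed i (a * b) = slice_embed i a * slice_embed i b"
  by (simp add: slice_embed_scaleR algebra_simps im_sphere_mult_self)

lemma slice_embed_1 [simp]: "slice_embed i 1 = 1"
  by (simp add: slice_embed_scaleR)

lemma slice_embed_inverse:
  assumes "i \<in> im_sphere"
  shows "slice_embed i (inverse a) = inverse (slice_embed i a)"
proof (cases "a = 0")
  case False
  then have "slice_embed i a * slice_embed i (inverse a) = 1"
    by (simp add: slice_embed_mult[OF assms, symmetric])
  then show ?thesis by (metis inverse_unique)
qed (simp add: slice_embed_scaleR)

lemma bounded_linear_slice_embed: "bounded_linear (slice_embed i)"
  unfolding slice_embed_scaleR[abs_def]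
  by (intro bounded_linear_add bounded_linear_scaleR_left[THEN bounded_linear_compose] bounded_linear_Re bounded_linear_Im)

lemmas slice_embed_add = linear_add[OF bounded_linear.linear[OF bounded_linear_slice_embed]]
lemmas slice_embed_diff = linear_diff[OF bounded_linear.linear[OF bounded_linear_slice_embed]]
lemmas continuous_on_slice_embed [continuous_intros] =
  bounded_linear.continuous_on[OF bounded_linear_slice_embed]

lemma qRe_slice_embed [simp]: "i \<in> im_sphere \<Longrightarrow> qRe (slice_embed i z) = Re z"
  by (simp add: slice_embed_scaleR im_sphere_def)

lemma qcnj_slice_embed: "i \<in> im_sphere \<Longrightarrow> qcnj (slice_embed i z) = slice_embed i (cnj z)"
  by (simp add: slice_embed_scaleR im_sphere_def qcnj_def quat_eq_iff)

lemma norm_slice_embed [simp]: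
  assumes "i \<in> im_sphere"
  shows "norm (slice_embed i z) = norm z"
proof -
  have i: "qRe i = 0" "(qI i)\<^sup>2 + (qJ i)\<^sup>2 + (qK i)\<^sup>2 = 1"
    using assms quat_norm_sq[of i] by (simp_all add: im_sphere_def)
  have "(Im z * qI i)\<^sup>2 + (Im z * qJ i)\<^sup>2 + (Im z * qK i)\<^sup>2 = (Im z)\<^sup>2 * ((qI i)\<^sup>2 + (qJ i)\<^sup>2 + (qK i)\<^sup>2)"
    by (simp add: power_mult_distrib distrib_left)
  then have "(Im z * qI i)\<^sup>2 + (Im z * qJ i)\<^sup>2 + (Im z * qK i)\<^sup>2 = (Im z)\<^sup>2"
    unfolding i(2) by simp
  then show ?thesis
    by (simp add: norm_quat_def slice_embed_scaleR cmod_def i(1) add.assoc)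
qed

lemma im_norm_slice_embed [simp]: "i \<in> im_sphere \<Longrightarrow> im_norm (slice_embed i z) = \<bar>Im z\<bar>"
  by (simp add: im_norm_def) (simp add: slice_embed_scaleR of_real_def im_sphere_def)

lemma slice_embed_cnj: "slice_embed i (cnj z) = slice_embed (- i) z"
  by (simp add: slice_embed_scaleR)

text \<open>The convention that the imaginary part is nonnegative assigns the unit
  \<open>- i\<close> to points with Im z < 0, hence the sign condition.\<close>

lemma im_unit_of_slice_embed:
  assumes "i \<in> im_sphere" "Im z \<ge> 0"
  shows "im_unit_of (slice_embed i z) i"
proof -
  have "slice_embed i z - of_real (qRe (slice_embed i z)) = i * of_real (Im z)"
    using assms(1) by (simp, simp add: slice_embed_def)
  then show ?thesis
    using assms by (auto simp: im_unit_of_def divide_inverse mult.assoc)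
qed

lemma im_unit_ofE:
  assumes "im_unit_of x i"
  shows "i \<in> im_sphere" "x = slice_embed i (Complex (qRe x) (im_norm x))"
proof -
  show "i \<in> im_sphere" using assms by (simp add: im_unit_of_def)
  show "x = slice_embed i (Complex (qRe x) (im_norm x))"
  proof (cases "im_norm x = 0")
    case True
    then show ?thesis by (simp add: slice_embed_def im_norm_def)
  next
    case False
    then have "i * of_real (im_norm x) = x - of_real (qRe x)"
      using assms by (auto simp: im_unit_of_def divide_inverse mult.assoc)
    then show ?thesis by (simp add: slice_embed_def)
  qed
qed

text \<open>For \<open>y\<close> a quaternion, \<open>slice_coord i y\<close> is linear over the plane of \<open>i\<close> acting from the left,
  and its real part is the inner product with \<open>y\<close>.  It thus reduces quaternion-valued
  identities to complex ones.\<close>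

definition slice_coord :: "quat \<Rightarrow> quat \<Rightarrow> quat \<Rightarrow> complex" where
  "slice_coord i y x = Complex (inner y x) (inner (i * y) x)"

lemma inner_im_sphere_mult: "i \<in> im_sphere \<Longrightarrow> inner y (i * x) = - inner (i * y) x"
  by (simp add: im_sphere_def inner_quat_def quat_times_sel algebra_simps)

lemma slice_coord_mult:
  "i \<in> im_sphere \<Longrightarrow> slice_coord i y (slice_embed i c * x) = c * slice_coord i y x"
  by (simp add: slice_coord_def slice_embed_scaleR complex_eq_iff inner_add_right
      inner_im_sphere_mult im_sphere_mult_mult algebra_simps)

lemma bounded_linear_slice_coord: "bounded_linear (slice_coord i y)"
proof -
  have "slice_coord i y = (\<lambda>x. of_real (inner y x) + \<i> * of_real (inner (i * y) x))"
    by (simp add: fun_eq_iff slice_coord_def complex_eq_iff)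
  then show ?thesis
    using bounded_linear_add[OF
        bounded_linear_compose[OF bounded_linear_of_real bounded_linear_inner_right[of y]]
        bounded_linear_compose[OF bounded_linear_mult_right[of \<i>]
          bounded_linear_compose[OF bounded_linear_of_real bounded_linear_inner_right[of "i * y"]]]]
    by simp
qed

text \<open>The real parts of the coordinates are the inner products with all y, and these determine
  a vector.\<close>

lemma quat_eq_slice_coordI:
  assumes "\<And>y. slice_coord i y x = slice_coord i y x'"
  shows "x = x'"
proof -
  have "\<forall>y. inner y x = inner y x'" using assms by (auto simp: slice_coord_def)
  then show ?thesis by (rule iffD1[OF vector_eq_ldot])
qed

section \<open>Slice hyperholomorphy in terms of stem functions\<close>

text \<open>The parity and Cauchy--Riemann conditions of \<open>slice_hyperholomorphic\<close>,
  separated from the formula that links them to the function.\<close>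

definition stem_system :: "(real \<Rightarrow> real \<Rightarrow> quat) \<Rightarrow> (real \<Rightarrow> real \<Rightarrow> quat) \<Rightarrow> bool" where
  "stem_system u v \<longleftrightarrow>
     (\<forall>a b. a\<^sup>2 + b\<^sup>2 < 1 \<longrightarrow>
        u a b = u a (- b) \<and> v a b = - v a (- b) \<and>
        (\<exists>p r.
           ((\<lambda>s. u s b) has_vector_derivative p) (at a) \<and>
           ((\<lambda>t. v a t) has_vector_derivative p) (at b) \<and>
           ((\<lambda>s. v s b) has_vector_derivative r) (at a) \<and>
           ((\<lambda>t. u a t) has_vector_derivative (- r)) (at b)))"

lemma stem_system_parity:
  "stem_system u v \<Longrightarrow> a\<^sup>2 + b\<^sup>2 < 1 \<Longrightarrow> u a (- b) = u a b"
  "stem_system u v \<Longrightarrow> a\<^sup>2 + b\<^sup>2 < 1 \<Longrightarrow> v a (- b) = - v a b"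
  unfolding stem_system_def by (metis, metis minus_equation_iff)

lemma norm_less_1_iff: "norm z < 1 \<longleftrightarrow> (Re z)\<^sup>2 + (Im z)\<^sup>2 < 1"
  using abs_square_less_1[of "norm z"] by (simp add: cmod_power2)

text \<open>The definition evaluates u and v at nonnegative second argument only. Replacing i by -i
  and z by its conjugate fixes the point, and parity of u and v absorbs both sign changes, so the
  formula extends to the whole disc of each slice.\<close>

lemma slice_hyperholomorphic_iff_stem:
  "slice_hyperholomorphic f \<longleftrightarrow>
     f differentiable_on ball 0 1 \<and>
     (\<exists>u v. stem_system u v \<and>
        (\<forall>i\<in>im_sphere. \<forall>z. norm z < 1 \<longrightarrow> f (slice_embed i z) = u (Re z) (Im z) + i * v (Re z) (Im z)))"
proof -
  have "(\<forall>x\<in>ball 0 1. \<forall>i. im_unit_of x i \<longrightarrow> f x = u (qRe x) (im_norm x) + i * v (qRe x) (im_norm x)) \<longleftrightarrow>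
      (\<forall>i\<in>im_sphere. \<forall>z. norm z < 1 \<longrightarrow> f (slice_embed i z) = u (Re z) (Im z) + i * v (Re z) (Im z))"
    (is "?A \<longleftrightarrow> ?B") if uv: "stem_system u v" for u v
  proof
    assume A: ?A
    show ?B
    proof (intro ballI allI impI)
      fix i z assume i: "i \<in> im_sphere" and z: "norm (z::complex) < 1"
      show "f (slice_embed i z) = u (Re z) (Im z) + i * v (Re z) (Im z)"
      proof (cases "Im z \<ge> 0")
        case True
        then show ?thesis
          using A[rule_format, OF _ im_unit_of_slice_embed[OF i True]] i z by simp
      next
        case False
        have "f (slice_embed (- i) (cnj z)) = u (Re z) (- Im z) + (- i) * v (Re z) (- Im z)"
          using A[rule_format, OF _ im_unit_of_slice_embed[OF im_sphere_uminus[OF i], of "cnj z"]]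
            im_sphere_uminus[OF i] z False by simp
        moreover have "slice_embed (- i) (cnj z) = slice_embed i z"
          by (simp add: slice_embed_cnj)
        ultimately show ?thesis
          using stem_system_parity[OF uv, of "Re z" "Im z"] z by (simp add: norm_less_1_iff)
      qed
    qed
  next
    assume B: ?B
    show ?A
    proof (intro ballI allI impI)
      fix x i assume x: "x \<in> ball (0::quat) 1" and "im_unit_of x i"
      note i = im_unit_ofE[OF this(2)]
      define z where "z = Complex (qRe x) (im_norm x)"
      have xz: "x = slice_embed i z" using i(2) by (simp add: z_def)
      have "norm z < 1" using x i(1) unfolding xz by simp
      then have "f (slice_embed i z) = u (Re z) (Im z) + i * v (Re z) (Im z)"
        using B i(1) by blast
      then show "f x = u (qRe x) (im_norm x) + i * v (qRe x) (im_norm x)"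
        unfolding xz[symmetric] by (simp add: z_def)
    qed
  qed
  then show ?thesis
    unfolding slice_hyperholomorphic_def stem_system_def[symmetric] by blast
qed

text \<open>On the slice of \<open>i\<close> the Cauchy--Riemann system says that the real
  derivative commutes with left multiplication by \<open>i\<close>. The map
  \<open>slice_coord i y\<close> turns this into complex linearity of the derivative.\<close>

lemma slice_hyperholomorphic_coord_holomorphic:
  assumes f: "slice_hyperholomorphic f" and i: "i \<in> im_sphere"
  shows "(\<lambda>z. slice_coord i y (f (slice_embed i z))) holomorphic_on ball 0 1"
proof -
  define F where "F z = f (slice_embed i z)" for z
  have "\<exists>c. ((\<lambda>z. slice_coord i y (F z)) has_field_derivative c) (at z)" if z: "norm z < 1" for z
  proof -
    have "f differentiable_on ball 0 1"
      using f unfolding slice_hyperholomorphic_def by (rule conjunct1)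
    moreover have "slice_embed i z \<in> ball 0 1" using z i by simp
    ultimately have "f differentiable (at (slice_embed i z))"
      by (simp add: differentiable_on_eq_differentiable_at)
    then have "F differentiable (at z)"
      unfolding F_def[abs_def]
      by (rule differentiable_chain_at[unfolded o_def, OF bounded_linear_imp_differentiable[OF bounded_linear_slice_embed]])
    then obtain D where D: "(F has_derivative D) (at z)" by (auto simp: differentiable_def)
    obtain u v where uv: "stem_system u v" and
      fuv: "\<forall>i\<in>im_sphere. \<forall>z. norm z < 1 \<longrightarrow> f (slice_embed i z) = u (Re z) (Im z) + i * v (Re z) (Im z)"
      using f unfolding slice_hyperholomorphic_iff_stem by blast
    obtain p r where
      u1: "((\<lambda>s. u s (Im z)) has_vector_derivative p) (at (Re z))" and
      v2: "((\<lambda>t. v (Re z) t) has_vector_derivative p) (at (Im z))" and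
      v1: "((\<lambda>s. v s (Im z)) has_vector_derivative r) (at (Re z))" and
      u2: "((\<lambda>t. u (Re z) t) has_vector_derivative (- r)) (at (Im z))"
      using uv[unfolded stem_system_def, rule_format, of "Re z" "Im z"] z
      unfolding norm_less_1_iff by blast
    have D1: "((\<lambda>s. F (Complex s (Im z))) has_vector_derivative D 1) (at (Re z))"
    proof -
      have "((\<lambda>s. Complex s (Im z)) has_vector_derivative 1) (at (Re z))"
        unfolding Complex_eq by (auto intro!: derivative_eq_intros)
      from vector_derivative_diff_chain_within[OF this, of F D] D show ?thesis
        by (simp add: o_def has_derivative_at_withinI)
    qed
    have D2: "((\<lambda>t. F (Complex (Re z) t)) has_vector_derivative D \<i>) (at (Im z))"
    proof -
      have "((\<lambda>t. Complex (Re z) t) has_vector_derivative \<i>) (at (Im z))"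
        unfolding Complex_eq by (auto intro!: derivative_eq_intros)
      from vector_derivative_diff_chain_within[OF this, of F D] D show ?thesis
        by (simp add: o_def has_derivative_at_withinI)
    qed
    \<comment> \<open>The formula through u and v is available inside the disc only, so derivatives
      are compared on open parameter sets.\<close>
    have op: "open {s. norm (Complex s (Im z)) < 1}" "open {t. norm (Complex (Re z) t) < 1}"
      unfolding Complex_eq by (intro open_Collect_less continuous_intros)+
    have "((\<lambda>s. F (Complex s (Im z))) has_vector_derivative (p + i * r)) (at (Re z))"
    proof (rule has_vector_derivative_transform_within_open[OF _ op(1)])
      show "((\<lambda>s. u s (Im z) + i * v s (Im z)) has_vector_derivative (p + i * r)) (at (Re z))"
        by (intro has_vector_derivative_add has_vector_derivative_mult_right u1 v1)
    qed (use z i in \<open>simp_all add: F_def fuv\<close>)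
    with D1 have 1: "D 1 = p + i * r" by (rule vector_derivative_unique_at)
    have "((\<lambda>t. F (Complex (Re z) t)) has_vector_derivative (- r + i * p)) (at (Im z))"
    proof (rule has_vector_derivative_transform_within_open[OF _ op(2)])
      show "((\<lambda>t. u (Re z) t + i * v (Re z) t) has_vector_derivative (- r + i * p)) (at (Im z))"
        by (intro has_vector_derivative_add has_vector_derivative_mult_right u2 v2)
    qed (use z i in \<open>simp_all add: F_def fuv\<close>)
    with D2 have "D \<i> = - r + i * p" by (rule vector_derivative_unique_at)
    \<comment> \<open>This is i * (p + i * r) = - r + i * p.\<close>
    then have 2: "D \<i> = slice_embed i \<i> * D 1"
      by (simp add: \<open>D 1 = p + i * r\<close> slice_embed_scaleR distrib_left im_sphere_mult_mult[OF i])
    have linD: "linear D" using D by (rule has_derivative_linear)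
    have "slice_coord i y (D w) = slice_coord i y (D 1) * w" for w
    proof -
      have "w = Re w *\<^sub>R 1 + Im w *\<^sub>R \<i>" by (simp add: complex_eq_iff)
      then have "D w = D (Re w *\<^sub>R 1 + Im w *\<^sub>R \<i>)" by (rule arg_cong)
      also have "\<dots> = Re w *\<^sub>R D 1 + Im w *\<^sub>R D \<i>"
        by (simp only: linear_add[OF linD] linear_scale[OF linD])
      also have "\<dots> = slice_embed i w * D 1"
        by (simp add: 2 slice_embed_scaleR distrib_right)
      finally show ?thesis using i by (simp add: slice_coord_mult mult.commute)
    qed
    then have "(\<lambda>w. slice_coord i y (D w)) = (*) (slice_coord i y (D 1))" by (rule ext)
    moreover have "((\<lambda>z. slice_coord i y (F z)) has_derivative (\<lambda>w. slice_coord i y (D w))) (at z)"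
      by (intro bounded_linear.has_derivative[OF bounded_linear_slice_coord] D)
    ultimately have "((\<lambda>z. slice_coord i y (F z)) has_field_derivative slice_coord i y (D 1)) (at z)"
      unfolding has_field_derivative_def by (simp only:)
    then show ?thesis by (rule exI)
  qed
  then show ?thesis
    unfolding F_def by (simp add: holomorphic_on_open)
qed

section \<open>Transfer of integrals from a slice to the complex disc\<close>

text \<open>The plane of \<open>i\<close> is a subspace of a finite-dimensional space, hence
  closed.\<close>

lemma slice_disc_borel [measurable]: "slice_disc i \<in> sets borel"
proof -
  have "subspace (range (slice_embed i))"
    by (intro linear_subspace_image bounded_linear.linear[OF bounded_linear_slice_embed] subspace_UNIV)
  then show ?thesis unfolding slice_disc_def
    by (intro sets.Int borel_open borel_closed closed_subspace) simp_all
qed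

lemma measurable_slice_embed [measurable]: "slice_embed i \<in> borel_measurable borel"
  by (intro borel_measurable_continuous_onI continuous_intros)

lemma indicator_slice_disc:
  "i \<in> im_sphere \<Longrightarrow> indicator (slice_disc i) (slice_embed i z) = indicator (ball 0 1) z"
  by (simp add: indicator_def slice_disc_def)

text \<open>The slice measure is built from an image measure under \<open>slice_embed i\<close>,
  which is isometric, so weight and disc pull back to those of \<open>disc_measure\<close>.
  Continuity on the ball makes the integrand Borel once it is cut off to
  \<open>slice_disc i\<close>.\<close>

lemma set_integral_slice_measure:
  fixes g :: "quat \<Rightarrow> quat"
  assumes \<alpha>: "\<alpha> > -1" and i: "i \<in> im_sphere" and g: "continuous_on (ball 0 1) g"
  shows "(LINT x:slice_disc i|slice_measure \<alpha> i. g x) = (LINT z|disc_measure \<alpha>. g (slice_embed i z))"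
proof -
  define g' where "g' x = indicator (slice_disc i) x *\<^sub>R g x" for x
  have g' [measurable]: "g' \<in> borel_measurable borel"
    unfolding g'_def
    by (intro borel_measurable_continuous_on_indicator continuous_on_subset[OF g] slice_disc_borel) (simp add: slice_disc_def)
  have gm: "(\<lambda>z. g (slice_embed i z)) \<in> borel_measurable (disc_measure \<alpha>)"
    using i by (intro continuous_on_measurable_disc continuous_on_compose2[OF g] continuous_intros) auto
  have "(LINT x:slice_disc i|slice_measure \<alpha> i. g x) =
      (LINT x|distr lborel borel (slice_embed i). ((\<alpha> + 1) / pi * (1 - (norm x)\<^sup>2) powr \<alpha>) *\<^sub>R g' x)"
    unfolding set_lebesgue_integral_def slice_measure_def g'_def[symmetric]
    using \<alpha> by (subst integral_density) auto
  also have "\<dots> = (LINT z|lborel. ((\<alpha> + 1) / pi * (1 - (norm (slice_embed i z))\<^sup>2) powr \<alpha>) *\<^sub>R g' (slice_embed i z))"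
    by (subst integral_distr) auto
  also have "\<dots> = (LINT z|disc_measure \<alpha>. g (slice_embed i z))"
    unfolding integral_disc_measure[OF \<alpha> gm] g'_def indicator_slice_disc[OF i] norm_slice_embed[OF i] ..
  finally show ?thesis .
qed

lemma nn_integral_slice_measure:
  fixes g :: "quat \<Rightarrow> real"
  assumes i: "i \<in> im_sphere" and g: "continuous_on (ball 0 1) g"
  shows "(\<integral>\<^sup>+x\<in>slice_disc i. ennreal (g x) \<partial>slice_measure \<alpha> i) =
    (\<integral>\<^sup>+z. ennreal (g (slice_embed i z)) \<partial>disc_measure \<alpha>)"
proof -
  define g' where "g' x = ennreal (g x) * indicator (slice_disc i) x" for x
  have "(\<lambda>x. indicator (slice_disc i) x *\<^sub>R g x) \<in> borel_measurable borel"
    by (intro borel_measurable_continuous_on_indicator continuous_on_subset[OF g] slice_disc_borel) (simp add: slice_disc_def)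
  then have "(\<lambda>x. ennreal (indicator (slice_disc i) x *\<^sub>R g x)) \<in> borel_measurable borel" by measurable
  moreover have "(\<lambda>x. ennreal (indicator (slice_disc i) x *\<^sub>R g x)) = g'"
    by (auto simp: g'_def fun_eq_iff indicator_def)
  ultimately have [measurable]: "g' \<in> borel_measurable borel" by simp
  have "(\<lambda>z. g (slice_embed i z)) \<in> borel_measurable (disc_measure \<alpha>)"
    using i by (intro continuous_on_measurable_disc continuous_on_compose2[OF g] continuous_intros) auto
  then have gm: "(\<lambda>z. ennreal (g (slice_embed i z))) \<in> borel_measurable (disc_measure \<alpha>)" by measurable
  have "(\<integral>\<^sup>+x\<in>slice_disc i. ennreal (g x) \<partial>slice_measure \<alpha> i) =
      (\<integral>\<^sup>+x. ennreal ((\<alpha> + 1) / pi * (1 - (norm x)\<^sup>2) powr \<alpha>) * g' x \<partial>distr lborel borel (slice_embed i))"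
    unfolding slice_measure_def g'_def[symmetric] by (subst nn_integral_density) auto
  also have "\<dots> = (\<integral>\<^sup>+z. ennreal ((\<alpha> + 1) / pi * (1 - (norm (slice_embed i z))\<^sup>2) powr \<alpha>) * g' (slice_embed i z) \<partial>lborel)"
    by (subst nn_integral_distr) auto
  also have "\<dots> = (\<integral>\<^sup>+z. ennreal (g (slice_embed i z)) \<partial>disc_measure \<alpha>)"
    unfolding nn_integral_disc_measure[OF gm] g'_def indicator_slice_disc[OF i] norm_slice_embed[OF i] ..
  finally show ?thesis .
qed

lemma slice_hyperholomorphic_continuous_on:
  "slice_hyperholomorphic f \<Longrightarrow> continuous_on (ball 0 1) f"
  unfolding slice_hyperholomorphic_iff_stem by (intro differentiable_imp_continuous_on) (rule conjunct1)

lemma continuous_on_slice_comp: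
  assumes "continuous_on (ball 0 1) f" "i \<in> im_sphere"
  shows "continuous_on (ball 0 1) (\<lambda>z. f (slice_embed i z))"
  using assms(2) by (intro continuous_on_compose2[OF assms(1)] continuous_intros) auto

text \<open>The measure is finite and x \<le> 1 + x^2, so square integrability implies
  integrability.\<close>

lemma bergman_space_integrable:
  assumes \<alpha>: "\<alpha> > -1" and i: "i \<in> im_sphere" and f: "f \<in> bergman_space \<alpha> i"
  shows "integrable (disc_measure \<alpha>) (\<lambda>z. f (slice_embed i z))"
proof -
  let ?M = "disc_measure \<alpha>"
  have c: "continuous_on (ball 0 1) f"
    using f by (auto simp: bergman_space_def intro: slice_hyperholomorphic_continuous_on)
  note c' = continuous_on_slice_comp[OF c i]
  have m [measurable]: "(\<lambda>z. f (slice_embed i z)) \<in> borel_measurable ?M"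
    by (rule continuous_on_measurable_disc[OF c'])
  have "(\<integral>\<^sup>+z. ennreal ((norm (f (slice_embed i z)))\<^sup>2) \<partial>?M) < \<infinity>"
    using f nn_integral_slice_measure[OF i, of "\<lambda>x. (norm (f x))\<^sup>2" \<alpha>] c
    by (simp add: bergman_space_def continuous_on_norm continuous_on_power)
  then have "integrable ?M (\<lambda>z. (norm (f (slice_embed i z)))\<^sup>2)"
    by (intro integrableI_nonneg) auto
  then have "integrable ?M (\<lambda>z. 1 + (norm (f (slice_embed i z)))\<^sup>2)"
    by (intro Bochner_Integration.integrable_add finite_measure.integrable_const[OF finite_measure_disc[OF \<alpha>]])
  then show ?thesis
  proof (rule Bochner_Integration.integrable_bound[OF _ m])
    have "x \<le> 1 + x\<^sup>2" for x :: real
    proof -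
      have "2 * x \<le> 1 + x\<^sup>2" using zero_le_power2[of "x - 1"] by (simp add: power2_diff)
      then show ?thesis using zero_le_power2[of x] by linarith
    qed
    then show "AE z in ?M. norm (f (slice_embed i z)) \<le> norm (1 + (norm (f (slice_embed i z)))\<^sup>2)"
      by (intro AE_I2) (simp add: abs_of_nonneg add_nonneg_nonneg)
  qed
qed

section \<open>Kernel bounds and the reproducing formula on one slice\<close>

text \<open>For a real exponent the modulus of the power is the power of the modulus, and |1 - x|
  \<ge> 1 - r.\<close>

lemma norm_kernel_le:
  fixes x :: complex
  assumes "norm x \<le> r" "r < 1" "s \<ge> 0"
  shows "norm ((1 - x) powr (- of_real s)) \<le> (1 - r) powr (- s)"
proof -
  have n: "1 - r \<le> norm (1 - x)" using assms norm_triangle_ineq2[of 1 x] by simp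
  then have "1 - x \<noteq> 0" using assms by auto
  then have "norm ((1 - x) powr (- of_real s)) = norm (1 - x) powr (- s)"
    by (simp add: powr_def norm_exp_eq_Re)
  also have "\<dots> \<le> (1 - r) powr (- s)" using n assms by (intro powr_mono2') auto
  finally show ?thesis .
qed

text \<open>The real part of 1 - x is positive, so the base of the kernel stays off the branch cut
  of the principal power.\<close>

lemma one_minus_notin_nonpos_Reals: "norm (x::complex) < 1 \<Longrightarrow> 1 - x \<notin> \<real>\<^sub>\<le>\<^sub>0"
  using complex_Re_le_cmod[of x] by (auto simp: complex_nonpos_Reals_iff)

lemma norm_mult_less_1: "norm (a::complex) < 1 \<Longrightarrow> norm b < 1 \<Longrightarrow> norm (a * b) < 1"
  using mult_strict_mono'[of "norm a" 1 "norm b" 1] by (simp add: norm_mult)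

lemma holomorphic_on_kernel:
  assumes "norm c < 1"
  shows "(\<lambda>z. (1 - c * z) powr a) holomorphic_on ball 0 1"
  using assms by (intro holomorphic_intros one_minus_notin_nonpos_Reals norm_mult_less_1) simp_all

text \<open>For fixed \<omega> the kernel is bounded on the disc, because |\<omega> cnj z| \<le>
  |\<omega>| < 1.\<close>

lemma integrable_disc_kernel:
  fixes f :: "complex \<Rightarrow> quat"
  assumes i: "i \<in> im_sphere" and s: "s \<ge> 0" and f: "integrable (disc_measure \<alpha>) f" and \<omega>: "norm \<omega> < 1"
  shows "integrable (disc_measure \<alpha>) (\<lambda>z. slice_embed i ((1 - \<omega> * cnj z) powr (- of_real s)) * f z)"
proof (rule Bochner_Integration.integrable_bound)
  let ?k = "\<lambda>z. slice_embed i ((1 - \<omega> * cnj z) powr (- of_real s))"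
  have [measurable]: "f \<in> borel_measurable (disc_measure \<alpha>)" using f by auto
  have "continuous_on (ball 0 1) (\<lambda>z. (1 - \<omega> * cnj z) powr (- of_real s))"
    by (rule continuous_on_compose2[OF holomorphic_on_imp_continuous_on[OF holomorphic_on_kernel[OF \<omega>]]])
      (auto intro!: continuous_intros)
  then have "continuous_on (ball 0 1) ?k" by (rule continuous_on_slice_embed)
  then have [measurable]: "?k \<in> borel_measurable (disc_measure \<alpha>)" by (rule continuous_on_measurable_disc)
  show "(\<lambda>z. ?k z * f z) \<in> borel_measurable (disc_measure \<alpha>)" by measurable
  show "integrable (disc_measure \<alpha>) (\<lambda>z. (1 - norm \<omega>) powr (- s) * norm (f z))" using f by simp
  show "AE z in disc_measure \<alpha>. norm (?k z * f z) \<le> norm ((1 - norm \<omega>) powr (- s) * norm (f z))"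
  proof (rule AE_I2)
    fix z assume "z \<in> space (disc_measure \<alpha>)"
    then have "norm (\<omega> * cnj z) \<le> norm \<omega>" by (simp add: norm_mult mult_left_le)
    then have "norm ((1 - \<omega> * cnj z) powr (- of_real s)) \<le> (1 - norm \<omega>) powr (- s)"
      using \<omega> s by (rule norm_kernel_le)
    then show "norm (?k z * f z) \<le> norm ((1 - norm \<omega>) powr (- s) * norm (f z))"
      using i by (simp add: norm_mult mult_right_mono)
  qed
qed

text \<open>Each \<open>slice_coord i y\<close> commutes with the integral and turns the kernel, a
  left factor from the plane of \<open>i\<close>, into a complex factor. What remains is
  \<open>disc_reproducing\<close> for a holomorphic coordinate of f.\<close>

lemma slice_reproducing:
  assumes \<alpha>: "\<alpha> > -1" and i: "i \<in> im_sphere" and f: "f \<in> bergman_space \<alpha> i" and \<omega>: "norm \<omega> < 1"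
  shows "(LINT z|disc_measure \<alpha>. slice_embed i ((1 - \<omega> * cnj z) powr (- of_real (2 + \<alpha>))) * f (slice_embed i z)) =
    f (slice_embed i \<omega>)"
proof (rule quat_eq_slice_coordI[where i = i])
  fix y
  note int = bergman_space_integrable[OF \<alpha> i f]
  have "slice_coord i y (LINT z|disc_measure \<alpha>. slice_embed i ((1 - \<omega> * cnj z) powr (- of_real (2 + \<alpha>))) * f (slice_embed i z)) =
      (LINT z|disc_measure \<alpha>. slice_coord i y (slice_embed i ((1 - \<omega> * cnj z) powr (- of_real (2 + \<alpha>))) * f (slice_embed i z)))"
    using \<alpha> by (intro integral_bounded_linear[symmetric] bounded_linear_slice_coord integrable_disc_kernel int i \<omega>) simp
  also have "\<dots> = (LINT z|disc_measure \<alpha>. (1 - \<omega> * cnj z) powr (- of_real (2 + \<alpha>)) * slice_coord i y (f (slice_embed i z)))"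
    unfolding slice_coord_mult[OF i] ..
  also have "\<dots> = slice_coord i y (f (slice_embed i \<omega>))"
    using f by (intro disc_reproducing \<alpha> \<omega> slice_hyperholomorphic_coord_holomorphic i
        integrable_bounded_linear[OF bounded_linear_slice_coord int]) (simp add: bergman_space_def)
  finally show "slice_coord i y (LINT z|disc_measure \<alpha>. slice_embed i ((1 - \<omega> * cnj z) powr (- of_real (2 + \<alpha>))) * f (slice_embed i z)) =
      slice_coord i y (f (slice_embed i \<omega>))" .
qed

section \<open>Stem functions built from a holomorphic function on the disc\<close>

text \<open>Together with \<open>stem_v\<close> this splits G into its even and odd parts under
  conjugation of z. For \<open>j\<close> in the sphere,
  \<open>stem_u j G z + j * stem_v j G z\<close> is \<open>slice_embed j (G z)\<close>; another unit
  in front of \<open>stem_v\<close> extends G to the other slices.\<close>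

definition stem_u :: "quat \<Rightarrow> (complex \<Rightarrow> complex) \<Rightarrow> complex \<Rightarrow> quat" where
  "stem_u j G z = slice_embed j ((G z + G (cnj z)) / 2)"

definition stem_v :: "quat \<Rightarrow> (complex \<Rightarrow> complex) \<Rightarrow> complex \<Rightarrow> quat" where
  "stem_v j G z = - (j * slice_embed j ((G z - G (cnj z)) / 2))"

lemma stem_parity:
  "stem_u j G (cnj z) = stem_u j G z" "stem_v j G (cnj z) = - stem_v j G z"
proof -
  have "(G (cnj z) - G z) / 2 = - ((G z - G (cnj z)) / 2)" by (simp add: minus_divide_left)
  then have "slice_embed j ((G (cnj z) - G z) / 2) = - slice_embed j ((G z - G (cnj z)) / 2)"
    by (simp only: linear_neg[OF bounded_linear.linear[OF bounded_linear_slice_embed]])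
  then show "stem_v j G (cnj z) = - stem_v j G z" by (simp add: stem_v_def)
qed (simp add: stem_u_def add.commute)

text \<open>The summand G (cnj z) is antiholomorphic, so the stem functions have real derivatives
  that also involve cnj h.\<close>

lemma stem_has_derivative:
  assumes G: "G holomorphic_on ball 0 1" and z: "norm z < 1"
  shows "(stem_u j G has_derivative
      (\<lambda>h. slice_embed j ((deriv G z * h + deriv G (cnj z) * cnj h) / 2))) (at z)" (is ?u)
    and "(stem_v j G has_derivative
      (\<lambda>h. - (j * slice_embed j ((deriv G z * h - deriv G (cnj z) * cnj h) / 2)))) (at z)" (is ?v)
proof -
  have 1: "(G has_derivative (\<lambda>h. deriv G z * h)) (at z)" if "norm z < 1" for z
    using holomorphic_derivI[OF G open_ball, of z] that by (simp add: has_field_derivative_def)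
  have 2: "((\<lambda>z. G (cnj z)) has_derivative (\<lambda>h. deriv G (cnj z) * cnj h)) (at z)"
    using has_derivative_compose[OF bounded_linear_imp_has_derivative[OF bounded_linear_cnj] 1[of "cnj z"]] z
    by simp
  show ?u
    unfolding stem_u_def[abs_def]
    by (intro bounded_linear.has_derivative[OF bounded_linear_slice_embed]
        bounded_linear.has_derivative[OF bounded_linear_divide] has_derivative_add 1 2 z)
  show ?v
    unfolding stem_v_def[abs_def]
    by (intro has_derivative_minus bounded_linear.has_derivative[OF bounded_linear_mult_right]
        bounded_linear.has_derivative[OF bounded_linear_slice_embed]
        bounded_linear.has_derivative[OF bounded_linear_divide] has_derivative_diff 1 2 z)
qed

text \<open>The partial derivatives are the real derivatives in the directions 1 and \<i>. As \<i>
  changes sign under conjugation, the second direction exchanges the sum and the difference of G'(z)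
  and G'(cnj z), which yields the Cauchy--Riemann system.\<close>

lemma stem_system_holomorphic:
  assumes G: "G holomorphic_on ball 0 1" and j: "j \<in> im_sphere"
  shows "stem_system (\<lambda>a b. stem_u j G (Complex a b)) (\<lambda>a b. stem_v j G (Complex a b))"
  unfolding stem_system_def
proof (intro allI impI conjI)
  fix a b :: real assume ab: "a\<^sup>2 + b\<^sup>2 < 1"
  define z where "z = Complex a b"
  have z: "norm z < 1" using ab by (simp add: norm_less_1_iff z_def)
  have cnj: "Complex a (- b) = cnj z" by (simp add: z_def complex_eq_iff)
  show "stem_u j G (Complex a b) = stem_u j G (Complex a (- b))"
    "stem_v j G (Complex a b) = - stem_v j G (Complex a (- b))"
    unfolding cnj z_def[symmetric] by (simp_all add: stem_parity)
  define p where "p = slice_embed j ((deriv G z + deriv G (cnj z)) / 2)"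
  define r where "r = - (j * slice_embed j ((deriv G z - deriv G (cnj z)) / 2))"
  have s: "((\<lambda>s. Complex s b) has_vector_derivative 1) (at a)"
    "((\<lambda>t. Complex a t) has_vector_derivative \<i>) (at b)"
    unfolding Complex_eq by (auto intro!: derivative_eq_intros)
  have chain: "((\<lambda>s. F (g s)) has_vector_derivative D g') (at x)"
    if "(F has_derivative D) (at z)" "(g has_vector_derivative g') (at x)" "g x = z"
    for F :: "complex \<Rightarrow> quat" and D g g' and x :: real
    using vector_derivative_diff_chain_within[OF that(2), of F D] that(1,3)
    by (simp add: o_def has_derivative_at_withinI)
  have embed_i: "slice_embed j (\<i> * c) = j * slice_embed j c" for c
    using j by (simp add: slice_embed_mult) (simp add: slice_embed_scaleR)
  note ders = stem_has_derivative[OF G z, of j]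
  have "((\<lambda>s. stem_u j G (Complex s b)) has_vector_derivative p) (at a)"
    using chain[OF ders(1) s(1)] by (simp add: z_def p_def)
  moreover have "((\<lambda>t. stem_v j G (Complex a t)) has_vector_derivative p) (at b)"
  proof -
    have "(deriv G z * \<i> - deriv G (cnj z) * cnj \<i>) / 2 = \<i> * ((deriv G z + deriv G (cnj z)) / 2)"
      by (simp add: field_simps)
    then show ?thesis
      using chain[OF ders(2) s(2)] j by (simp add: z_def[symmetric] p_def embed_i im_sphere_mult_mult del: times_divide_eq_right)
  qed
  moreover have "((\<lambda>s. stem_v j G (Complex s b)) has_vector_derivative r) (at a)"
    using chain[OF ders(2) s(1)] by (simp add: z_def r_def)
  moreover have "((\<lambda>t. stem_u j G (Complex a t)) has_vector_derivative (- r)) (at b)"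
  proof -
    have "(deriv G z * \<i> + deriv G (cnj z) * cnj \<i>) / 2 = \<i> * ((deriv G z - deriv G (cnj z)) / 2)"
      by (simp add: field_simps)
    then show ?thesis
      using chain[OF ders(1) s(2)] by (simp add: z_def[symmetric] r_def embed_i del: times_divide_eq_right)
  qed
  ultimately show "\<exists>p r.
      ((\<lambda>s. stem_u j G (Complex s b)) has_vector_derivative p) (at a) \<and>
      ((\<lambda>t. stem_v j G (Complex a t)) has_vector_derivative p) (at b) \<and>
      ((\<lambda>s. stem_v j G (Complex s b)) has_vector_derivative r) (at a) \<and>
      ((\<lambda>t. stem_u j G (Complex a t)) has_vector_derivative (- r)) (at b)" by blast
qed

lemma norm_im_sphere: "i \<in> im_sphere \<Longrightarrow> norm i = 1"
  by (simp add: im_sphere_def)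

definition slice_coords :: "quat \<Rightarrow> complex" where
  "slice_coords x = Complex (qRe x) (im_norm x)"

text \<open>At a real point the map \<open>x \<mapsto> im_norm x\<close> is not differentiable; there the
  Cauchy--Riemann equations combine the linear parts of the two stem functions into
  \<open>h \<mapsto> h * p\<close>.\<close>

lemma stem_differentiable:
  fixes f :: "quat \<Rightarrow> quat"
  assumes G: "G holomorphic_on ball 0 1" and j: "j \<in> im_sphere"
    and J: "\<And>x. im_unit_of x (J x)"
    and f: "\<And>x. f x = stem_u j G (slice_coords x) + J x * stem_v j G (slice_coords x)"
  shows "f differentiable_on ball 0 1"
proof -
  have emb: "slice_embed (J x) (slice_coords x) = x" and Jx: "J x \<in> im_sphere" for x
    using im_unit_ofE[OF J[of x]] by (simp_all add: slice_coords_def)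
  have nx: "norm (slice_coords x) = norm x" for x
    using norm_slice_embed[OF Jx, of x "slice_coords x"] by (simp add: emb)
  have "f differentiable (at x)" if x: "norm x < 1" for x
  proof (cases "im_norm x = 0")
    case True
    define c where "c = slice_coords x"
    have Imc: "Im c = 0" and Rec: "of_real (Re c) = x"
      using True by (simp_all add: c_def slice_coords_def im_norm_def)
    have c: "norm c < 1" "cnj c = c" using x Imc by (simp_all add: c_def nx complex_eq_iff)
    \<comment> \<open>Since \<open>c\<close> is its own conjugate, both stem derivatives are
      multiples of this one value: by Re h for \<open>stem_u\<close> and by Im h for
      \<open>stem_v\<close>.\<close>
    define p where "p = slice_embed j (deriv G c)"
    note scale = linear_scale[OF bounded_linear.linear[OF bounded_linear_slice_embed]]
    have u_eq: "(deriv G c * h + deriv G c * cnj h) / 2 = Re h *\<^sub>R deriv G c" for h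
      unfolding distrib_left[symmetric] complex_add_cnj by (simp add: scaleR_conv_of_real)
    have u: "(stem_u j G has_derivative (\<lambda>h. Re h *\<^sub>R p)) (at c)"
      using stem_has_derivative(1)[OF G c(1), of j] unfolding c(2) u_eq scale p_def[symmetric] .
    have v_eq: "(deriv G c * h - deriv G c * cnj h) / 2 = \<i> * (Im h *\<^sub>R deriv G c)" for h
      unfolding right_diff_distrib[symmetric] complex_diff_cnj by (simp add: scaleR_conv_of_real)
    have v_eq': "- (j * slice_embed j (\<i> * (t *\<^sub>R d))) = t *\<^sub>R slice_embed j d" for t d
      using j by (simp add: slice_embed_mult scale)
        (simp add: slice_embed_scaleR[of j \<i>] im_sphere_mult_mult)
    have v: "(stem_v j G has_derivative (\<lambda>h. Im h *\<^sub>R p)) (at c)"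
      using stem_has_derivative(2)[OF G c(1), of j] unfolding c(2) v_eq v_eq' p_def[symmetric] .
    have vc: "stem_v j G c = 0" by (simp add: stem_v_def c(2) slice_embed_scaleR)
    have "(f has_derivative (\<lambda>h. h * p)) (at x)"
      unfolding has_derivative_at_alt
    proof (intro conjI allI impI bounded_linear_mult_left)
      fix e :: real assume "e > 0"
      then have "e / 2 > 0" by simp
      then obtain d1 where d1: "d1 > 0" "\<And>z. norm (z - c) < d1 \<Longrightarrow>
          norm (stem_u j G z - stem_u j G c - Re (z - c) *\<^sub>R p) \<le> e / 2 * norm (z - c)"
        using u unfolding has_derivative_at_alt by blast
      obtain d2 where d2: "d2 > 0" "\<And>z. norm (z - c) < d2 \<Longrightarrow>
          norm (stem_v j G z - stem_v j G c - Im (z - c) *\<^sub>R p) \<le> e / 2 * norm (z - c)"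
        using v \<open>e / 2 > 0\<close> unfolding has_derivative_at_alt by blast
      show "\<exists>d>0. \<forall>y. norm (y - x) < d \<longrightarrow> norm (f y - f x - (y - x) * p) \<le> e * norm (y - x)"
      proof (intro exI[of _ "min d1 d2"] conjI allI impI)
        fix y assume y: "norm (y - x) < min d1 d2"
        define z where "z = slice_coords y"
        \<comment> \<open>A real x lies in every slice, in particular in that of y. The increment
          thus has norm |z - c|, and the estimates are uniform in the unit
          \<open>J y\<close>.\<close>
        have yx: "y - x = slice_embed (J y) (z - c)"
          using emb[of y] Imc by (simp add: z_def slice_embed_diff slice_embed_def[of _ c] Rec)
        then have n: "norm (y - x) = norm (z - c)" using Jx by simp
        define U where "U = stem_u j G z - stem_u j G c - Re (z - c) *\<^sub>R p"
        define V where "V = stem_v j G z - stem_v j G c - Im (z - c) *\<^sub>R p"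
        have "f y - f x - (y - x) * p = U + J y * V"
          unfolding f yx U_def V_def z_def[symmetric] c_def[symmetric] vc
          by (simp add: slice_embed_scaleR algebra_simps)
        also have "norm \<dots> \<le> norm U + norm V"
          using norm_triangle_ineq[of U "J y * V"] by (simp add: norm_mult norm_im_sphere[OF Jx])
        also have "\<dots> \<le> e / 2 * norm (z - c) + e / 2 * norm (z - c)"
          using d1(2)[of z] d2(2)[of z] y n unfolding U_def V_def by (intro add_mono) auto
        also have "\<dots> = e * norm (y - x)" by (simp add: n)
        finally show "norm (f y - f x - (y - x) * p) \<le> e * norm (y - x)" .
      qed (use d1 d2 in auto)
    qed
    then show ?thesis by (rule differentiableI)
  next
    case False
    have im: "im_norm = (\<lambda>x. norm (x - qRe x *\<^sub>R 1))" by (simp add: fun_eq_iff im_norm_def of_real_def)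
    have qRe: "bounded_linear qRe"
      using bounded_linear_inner_right[of "1::quat"] by (simp add: inner_quat_def[abs_def])
    have dRe: "qRe differentiable (at x)" by (rule bounded_linear_imp_differentiable[OF qRe])
    have dI: "(\<lambda>x. x - qRe x *\<^sub>R 1) differentiable (at x)"
      by (intro derivative_intros dRe)
    have dim: "im_norm differentiable (at x)"
      using differentiable_chain_at[OF dI, of norm] False by (simp add: im o_def)
    have eq: "slice_coords = (\<lambda>x. qRe x *\<^sub>R 1 + im_norm x *\<^sub>R \<i>)"
      by (simp add: fun_eq_iff slice_coords_def complex_eq_iff)
    have dE: "slice_coords differentiable (at x)"
      unfolding eq by (intro derivative_intros dRe dim)
    have z: "norm (slice_coords x) < 1" using x by (simp add: nx)
    have du: "(\<lambda>x. stem_u j G (slice_coords x)) differentiable (at x)"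
      using differentiable_chain_at[OF dE differentiableI[OF stem_has_derivative(1)[OF G z]]] by (simp add: o_def)
    have dv: "(\<lambda>x. stem_v j G (slice_coords x)) differentiable (at x)"
      using differentiable_chain_at[OF dE differentiableI[OF stem_has_derivative(2)[OF G z]]] by (simp add: o_def)
    \<comment> \<open>Off the real axis the unit is given by a differentiable formula; with it in
      place of \<open>J\<close>, the function agrees with \<open>f\<close> on the open set of
      non-real points.\<close>
    define g where "g x = stem_u j G (slice_coords x) + (inverse (im_norm x) *\<^sub>R (x - qRe x *\<^sub>R 1)) * stem_v j G (slice_coords x)" for x
    have "g differentiable (at x)"
      unfolding g_def by (intro derivative_intros du dv dI dim False)
    then obtain D where D: "(g has_derivative D) (at x)" by (auto simp: differentiable_def)
    have op: "open {x. im_norm x \<noteq> 0}"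
      unfolding im by (intro open_Collect_neq continuous_intros linear_continuous_on qRe)
    have "(f has_derivative D) (at x)"
    proof (rule has_derivative_transform_within_open[OF D op])
      fix y assume "y \<in> {x. im_norm x \<noteq> 0}"
      then have "J y = inverse (im_norm y) *\<^sub>R (y - qRe y *\<^sub>R 1)"
        using J[of y] by (simp add: im_unit_of_def divide_inverse of_real_def inverse_scaleR_distrib)
      then show "g y = f y" by (simp add: f g_def)
    qed (use False in simp)
    then show ?thesis by (rule differentiableI)
  qed
  then show ?thesis by (simp add: differentiable_on_eq_differentiable_at)
qed

section \<open>The slice Bergman kernel\<close>

text \<open>Off the real axis the admissible unit k is i or -i according to the sign of Im z, and
  parity absorbs the sign. At real points k is arbitrary, but the odd part vanishes.\<close>

lemma stem_slice_embed:
  assumes J: "im_unit_of (slice_embed i z) k" and i: "i \<in> im_sphere"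
  shows "stem_u j G (slice_coords (slice_embed i z)) + k * stem_v j G (slice_coords (slice_embed i z)) =
    stem_u j G z + i * stem_v j G z"
proof -
  define z' where "z' = slice_coords (slice_embed i z)"
  have z': "z' = Complex (Re z) \<bar>Im z\<bar>" using i by (simp add: z'_def slice_coords_def)
  have "slice_embed i z = slice_embed k z'" using im_unit_ofE(2)[OF J] by (simp add: z'_def slice_coords_def)
  then have eq: "Im z *\<^sub>R i = \<bar>Im z\<bar> *\<^sub>R k" by (simp add: slice_embed_scaleR z')
  consider "Im z = 0" | "Im z > 0" | "Im z < 0" by linarith
  then show ?thesis
  proof cases
    case 1
    then have "z' = z" "cnj z = z" by (simp_all add: z' complex_eq_iff)
    then show ?thesis unfolding z'_def[symmetric] by (simp add: stem_v_def slice_embed_scaleR)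
  next
    case 2
    then have "z' = z" "i = k" using eq by (simp_all add: z' complex_eq_iff)
    then show ?thesis unfolding z'_def[symmetric] by simp
  next
    case 3
    have "z' = cnj z" using 3 by (simp add: z' complex_eq_iff)
    moreover have "Im z *\<^sub>R i = Im z *\<^sub>R (- k)" using eq 3 by simp
    then have "k = - i" using 3 by (simp del: scaleR_minus_right)
    ultimately show ?thesis unfolding z'_def[symmetric] by (simp add: stem_parity)
  qed
qed

lemma slice_powr_embed:
  assumes "i \<in> im_sphere"
  shows "1 / slice_powr i (slice_embed i c) s = slice_embed i (c powr (- of_real s))"
proof -
  have "inner i (slice_embed i c) = Im c"
  proof -
    have "inner i i = 1" using norm_im_sphere[OF assms] by (simp add: dot_square_norm)
    moreover have "inner i 1 = 0" using assms by (simp add: inner_quat_def im_sphere_def)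
    ultimately show ?thesis by (simp add: slice_embed_scaleR inner_add_right)
  qed
  then show ?thesis
    using assms by (simp add: slice_powr_def powr_minus slice_embed_inverse divide_inverse)
qed

lemma half_quat: "(1/2 :: quat) * x = (1/2) *\<^sub>R x"
proof -
  have "(1/2 :: quat) = (1/2) *\<^sub>R 1" unfolding of_real_def[symmetric] by (simp add: of_real_divide)
  then show ?thesis by (simp only: mult_scaleR_left mult_1_left)
qed

text \<open>The weighted Bergman kernel of the complex disc, conjugated in \<omega> so that it is
  holomorphic in z; the integrand of \<open>disc_reproducing\<close> contains its complex
  conjugate.\<close>

definition disc_kernel :: "real \<Rightarrow> complex \<Rightarrow> complex \<Rightarrow> complex" where
  "disc_kernel \<alpha> \<omega> z = (1 - cnj \<omega> * z) powr (- of_real (2 + \<alpha>))"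

text \<open>Collecting the terms with and without \<open>J q\<close> leaves the even and odd parts
  of the disc kernel in the plane of \<open>J w\<close>, so the kernel is the slice extension of
  \<open>disc_kernel\<close> from that plane.\<close>

lemma bergman_kernel_stem:
  assumes J: "\<And>x. im_unit_of x (J x)"
  shows "bergman_kernel J \<alpha> q w =
    stem_u (J w) (disc_kernel \<alpha> (slice_coords w)) (slice_coords q) +
    J q * stem_v (J w) (disc_kernel \<alpha> (slice_coords w)) (slice_coords q)"
proof -
  let ?G = "disc_kernel \<alpha> (slice_coords w)"
  define z where "z = slice_coords q"
  define \<omega> where "\<omega> = slice_coords w"
  have Jw: "J w \<in> im_sphere" using im_unit_ofE(1)[OF J] .
  have w: "w = slice_embed (J w) \<omega>" using im_unit_ofE(2)[OF J[of w]] by (simp add: \<omega>_def slice_coords_def)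
  have q': "of_real (qRe q) + J w * of_real (im_norm q) = slice_embed (J w) z"
    by (simp add: slice_embed_def z_def slice_coords_def)
  have cw: "qcnj w = slice_embed (J w) (cnj \<omega>)" by (subst w) (rule qcnj_slice_embed[OF Jw])
  have P: "1 - slice_embed (J w) x * qcnj w = slice_embed (J w) (1 - cnj \<omega> * x)" for x
    by (simp add: cw slice_embed_mult[OF Jw, symmetric] slice_embed_diff mult.commute)
  have "bergman_kernel J \<alpha> q w =
      (1/2) *\<^sub>R ((1 - J q * J w) * slice_embed (J w) (?G z)) + (1/2) *\<^sub>R ((1 + J q * J w) * slice_embed (J w) (?G (cnj z)))"
    unfolding bergman_kernel_def Let_def q' qcnj_slice_embed[OF Jw] P slice_powr_embed[OF Jw] disc_kernel_def \<omega>_def[symmetric]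
    by (simp only: half_quat mult_scaleR_left)
  also have "\<dots> = stem_u (J w) ?G z + J q * stem_v (J w) ?G z"
  proof -
    have h: "slice_embed (J w) (c / 2) = (1/2) *\<^sub>R slice_embed (J w) c" for c
      by (simp add: slice_embed_scaleR scaleR_add_right)
    show ?thesis
      by (simp add: stem_u_def stem_v_def h slice_embed_add slice_embed_diff algebra_simps)
  qed
  finally show ?thesis by (simp add: z_def)
qed

section \<open>The conjugate of the kernel seen from another slice\<close>

lemma qcnj_mult: "qcnj (x * y) = qcnj y * qcnj x"
  by (simp add: quat_eq_iff qcnj_def quat_times_sel algebra_simps)

lemma bounded_linear_qcnj: "bounded_linear qcnj"
proof (rule bounded_linear_intro[of _ 1])
  show "norm (qcnj x) \<le> norm x * 1" for x by (simp add: qcnj_def norm_quat_def)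
qed (simp_all add: qcnj_def quat_eq_iff)

lemma qcnj_im_sphere: "i \<in> im_sphere \<Longrightarrow> qcnj i = - i"
  by (simp add: qcnj_def quat_eq_iff im_sphere_def)

text \<open>By linearity it suffices to check the units: j (1 - j i) = i + j = (1 - j i) i and -j (1
  + j i) = i - j = (1 + j i) i.\<close>

lemma slice_embed_intertwine:
  assumes i: "i \<in> im_sphere" and j: "j \<in> im_sphere"
  shows "slice_embed j c * (1 - j * i) = (1 - j * i) * slice_embed i c"
    and "slice_embed j (cnj c) * (1 + j * i) = (1 + j * i) * slice_embed i c"
  by (simp_all add: slice_embed_scaleR algebra_simps im_sphere_mult_mult[OF j] im_sphere_mult_self[OF i])

text \<open>Conjugation reverses products and puts the values from the plane of \<open>j\<close> on
  the left. Moving them past the intertwining factors brings them into the plane of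
  \<open>i\<close>, next to f, as \<open>slice_reproducing\<close> requires.\<close>

lemma qcnj_stem:
  assumes i: "i \<in> im_sphere" and j: "j \<in> im_sphere"
  shows "qcnj (stem_u j G z + i * stem_v j G z) =
    (1/2) *\<^sub>R ((1 - j * i) * slice_embed i (cnj (G z)) + (1 + j * i) * slice_embed i (G (cnj z)))"
proof -
  have h: "slice_embed j (c / 2) = (1/2) *\<^sub>R slice_embed j c" for c
    by (simp add: slice_embed_scaleR scaleR_add_right)
  have "stem_u j G z + i * stem_v j G z =
      (1/2) *\<^sub>R ((1 - i * j) * slice_embed j (G z) + (1 + i * j) * slice_embed j (G (cnj z)))"
    by (simp add: stem_u_def stem_v_def h slice_embed_add slice_embed_diff algebra_simps)
  moreover have "qcnj (1 - i * j) = 1 - j * i" "qcnj (1 + i * j) = 1 + j * i"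
    using qcnj_mult[of i j] qcnj_im_sphere[OF i] qcnj_im_sphere[OF j]
      linear_add[OF bounded_linear.linear[OF bounded_linear_qcnj], of 1 "i * j"]
      linear_diff[OF bounded_linear.linear[OF bounded_linear_qcnj], of 1 "i * j"]
      qcnj_slice_embed[OF i, of 1]
    by simp_all
  ultimately have "qcnj (stem_u j G z + i * stem_v j G z) =
      (1/2) *\<^sub>R (slice_embed j (cnj (G z)) * (1 - j * i) + slice_embed j (cnj (G (cnj z))) * (1 + j * i))"
    by (simp add: linear_scale[OF bounded_linear.linear[OF bounded_linear_qcnj]]
        linear_add[OF bounded_linear.linear[OF bounded_linear_qcnj]] qcnj_mult qcnj_slice_embed[OF j])
  then show ?thesis unfolding slice_embed_intertwine[OF i j] by simp
qed

lemma norm_stem_le: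
  assumes i: "i \<in> im_sphere" and j: "j \<in> im_sphere" and "norm (G z) \<le> B" "norm (G (cnj z)) \<le> B"
  shows "norm (stem_u j G z + i * stem_v j G z) \<le> 2 * B"
proof -
  have "norm (stem_u j G z + i * stem_v j G z) \<le> norm ((G z + G (cnj z)) / 2) + norm ((G z - G (cnj z)) / 2)"
    using norm_triangle_ineq[of "stem_u j G z" "i * stem_v j G z"] i j
    by (simp add: stem_u_def stem_v_def norm_mult norm_im_sphere)
  also have "\<dots> \<le> 2 * B"
    using norm_triangle_ineq[of "G z" "G (cnj z)"] norm_triangle_ineq4[of "G z" "G (cnj z)"] assms(3,4)
    by (simp add: norm_divide)
  finally show ?thesis .
qed

section \<open>Membership in the Bergman space and the reproducing property\<close>

text \<open>The stem form gives slice hyperholomorphy. For fixed w the kernel is bounded on the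
  slice, and the measure is finite.\<close>

lemma bergman_kernel_mem:
  assumes \<alpha>: "\<alpha> > -1" and i: "i \<in> im_sphere" and J: "\<And>x. im_unit_of x (J x)" and w: "norm w < 1"
  shows "(\<lambda>q. bergman_kernel J \<alpha> q w) \<in> bergman_space \<alpha> i"
proof -
  let ?K = "\<lambda>q. bergman_kernel J \<alpha> q w" and ?M = "disc_measure \<alpha>"
  define \<omega> where "\<omega> = slice_coords w"
  define G where "G = disc_kernel \<alpha> \<omega>"
  have Jw: "J w \<in> im_sphere" using im_unit_ofE(1)[OF J] .
  have "slice_embed (J w) \<omega> = w" using im_unit_ofE(2)[OF J[of w]] by (simp add: \<omega>_def slice_coords_def)
  then have \<omega>: "norm \<omega> < 1" using w norm_slice_embed[OF Jw, of \<omega>] by simp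
  have G: "G holomorphic_on ball 0 1"
    unfolding G_def disc_kernel_def[abs_def] using \<omega> by (intro holomorphic_on_kernel) simp
  have K: "?K q = stem_u (J w) G (slice_coords q) + J q * stem_v (J w) G (slice_coords q)" for q
    unfolding bergman_kernel_stem[OF J] G_def \<omega>_def ..
  have Ki: "?K (slice_embed k z) = stem_u (J w) G z + k * stem_v (J w) G z" if "k \<in> im_sphere" for k z
    unfolding K using that by (rule stem_slice_embed[OF J])
  have hyp: "slice_hyperholomorphic ?K"
    unfolding slice_hyperholomorphic_iff_stem
  proof (intro conjI exI ballI allI impI)
    show "?K differentiable_on ball 0 1" using stem_differentiable[OF G Jw J K] .
    show "stem_system (\<lambda>a b. stem_u (J w) G (Complex a b)) (\<lambda>a b. stem_v (J w) G (Complex a b))"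
      using G Jw by (rule stem_system_holomorphic)
  qed (simp add: Ki)
  define B where "B = (1 - norm \<omega>) powr (- (2 + \<alpha>))"
  have GB: "norm (G z) \<le> B" if "norm z < 1" for z
  proof -
    have "norm (cnj \<omega> * z) \<le> norm \<omega>" using that by (simp add: norm_mult mult_left_le)
    then show ?thesis unfolding G_def disc_kernel_def B_def using \<omega> \<alpha> by (intro norm_kernel_le) simp_all
  qed
  have "(\<integral>\<^sup>+x\<in>slice_disc i. ennreal ((norm (?K x))\<^sup>2) \<partial>slice_measure \<alpha> i) =
      (\<integral>\<^sup>+z. ennreal ((norm (?K (slice_embed i z)))\<^sup>2) \<partial>?M)"
    using slice_hyperholomorphic_continuous_on[OF hyp]
    by (intro nn_integral_slice_measure i continuous_intros)
  also have "\<dots> \<le> (\<integral>\<^sup>+z. ennreal ((2 * B)\<^sup>2) \<partial>?M)"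
  proof (intro nn_integral_mono ennreal_leI power_mono norm_ge_zero)
    fix z assume "z \<in> space ?M"
    then show "norm (?K (slice_embed i z)) \<le> 2 * B"
      unfolding Ki[OF i] by (intro norm_stem_le i Jw GB) simp_all
  qed
  also have "\<dots> < \<infinity>"
    using finite_measure.emeasure_finite[OF finite_measure_disc[OF \<alpha>], of "ball 0 1"]
    by (simp add: ennreal_mult_less_top less_top)
  finally show ?thesis using hyp by (simp add: bergman_space_def)
qed

theorem lemma5p9:
  fixes \<alpha> :: real and i :: quat and J :: "quat \<Rightarrow> quat"
  assumes "\<alpha> > -1"
    and "i \<in> im_sphere"
    and "\<forall>x. im_unit_of x (J x)"
  shows "\<forall>w\<in>ball 0 1.
           (\<lambda>q. bergman_kernel J \<alpha> q w) \<in> bergman_space \<alpha> i \<and>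
           (\<forall>f\<in>bergman_space \<alpha> i.
              bergman_inner \<alpha> i (\<lambda>q. bergman_kernel J \<alpha> q w) f = f w)"
proof (intro ballI conjI)
  note \<alpha> = assms(1) and i = assms(2)
  have J: "im_unit_of x (J x)" for x using assms(3) by blast
  fix w :: quat assume "w \<in> ball 0 1"
  then have w: "norm w < 1" by simp
  let ?K = "\<lambda>q. bergman_kernel J \<alpha> q w" and ?M = "disc_measure \<alpha>"
  show mem: "?K \<in> bergman_space \<alpha> i" using \<alpha> i J w by (rule bergman_kernel_mem)
  fix f assume f: "f \<in> bergman_space \<alpha> i"
  define \<omega> where "\<omega> = slice_coords w"
  define k where "k \<omega> z = (1 - \<omega> * cnj z) powr (- of_real (2 + \<alpha>))" for \<omega> z
  define j where "j = J w"
  have j: "j \<in> im_sphere" unfolding j_def using im_unit_ofE(1)[OF J] .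
  have w_eq: "slice_embed j \<omega> = w" using im_unit_ofE(2)[OF J[of w]] by (simp add: \<omega>_def j_def slice_coords_def)
  then have \<omega>: "norm \<omega> < 1" using w norm_slice_embed[OF j, of \<omega>] by simp
  have qK: "qcnj (?K (slice_embed i z)) =
      (1/2) *\<^sub>R ((1 - j * i) * slice_embed i (k \<omega> z) + (1 + j * i) * slice_embed i (k (cnj \<omega>) z))"
    if z: "norm z < 1" for z
  proof -
    \<comment> \<open>Off the branch cut, conjugation commutes with the principal power.\<close>
    have "1 - cnj \<omega> * z \<notin> \<real>\<^sub>\<le>\<^sub>0"
      using \<omega> z by (intro one_minus_notin_nonpos_Reals norm_mult_less_1) simp_all
    then have "Re (1 - cnj \<omega> * z) \<ge> 0" if "Im (1 - cnj \<omega> * z) = 0"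
      using that unfolding complex_nonpos_Reals_iff by linarith
    from cnj_powr[OF this, of "- of_real (2 + \<alpha>)"]
    have "cnj ((1 - cnj \<omega> * z) powr (- of_real (2 + \<alpha>))) = k \<omega> z" by (simp add: k_def)
    then show ?thesis
      unfolding bergman_kernel_stem[OF J] stem_slice_embed[OF J i] j_def[symmetric] \<omega>_def[symmetric]
        qcnj_stem[OF i j] disc_kernel_def by (simp add: k_def)
  qed
  have cK: "continuous_on (ball 0 1) ?K" and cf: "continuous_on (ball 0 1) f"
    using mem f by (simp_all add: bergman_space_def slice_hyperholomorphic_continuous_on)
  have "bergman_inner \<alpha> i ?K f = (LINT z|?M. qcnj (?K (slice_embed i z)) * f (slice_embed i z))"
    unfolding bergman_inner_def
    by (intro set_integral_slice_measure \<alpha> i continuous_on_mult cf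
        bounded_linear.continuous_on[OF bounded_linear_qcnj cK])
  also have "\<dots> = (LINT z|?M. (1/2) *\<^sub>R ((1 - j * i) * (slice_embed i (k \<omega> z) * f (slice_embed i z)) +
      (1 + j * i) * (slice_embed i (k (cnj \<omega>) z) * f (slice_embed i z))))"
    by (intro Bochner_Integration.integral_cong refl) (simp add: qK distrib_right mult.assoc)
  also have "\<dots> = (1/2) *\<^sub>R ((1 - j * i) * f (slice_embed i \<omega>) + (1 + j * i) * f (slice_embed i (cnj \<omega>)))"
  proof -
    have int: "integrable ?M (\<lambda>z. slice_embed i (k \<omega> z) * f (slice_embed i z))" if "norm \<omega> < 1" for \<omega>
      unfolding k_def using \<alpha> that by (intro integrable_disc_kernel i bergman_space_integrable f) simp_all
    have rep: "(LINT z|?M. slice_embed i (k \<omega> z) * f (slice_embed i z)) = f (slice_embed i \<omega>)" if "norm \<omega> < 1" for \<omega>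
      unfolding k_def using \<alpha> i f that by (rule slice_reproducing)
    have "norm (cnj \<omega>) < 1" using \<omega> by simp
    then show ?thesis
      using \<omega> by (simp add: int rep)
  qed
  also have "\<dots> = f w"
  proof -
    obtain u v where fuv: "\<forall>i\<in>im_sphere. \<forall>z. norm z < 1 \<longrightarrow>
        f (slice_embed i z) = u (Re z) (Im z) + i * v (Re z) (Im z)"
      using f unfolding bergman_space_def slice_hyperholomorphic_iff_stem by blast
    define a where "a = u (Re \<omega>) (Im \<omega>)"
    define b where "b = v (Re \<omega>) (Im \<omega>)"
    have e: "f (slice_embed i \<omega>) = a + i * b" "f (slice_embed i (cnj \<omega>)) = a + (- i) * b" "f w = a + j * b"
      unfolding slice_embed_cnj w_eq[symmetric] using fuv \<omega> i j im_sphere_uminus[OF i] by (simp_all add: a_def b_def)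
    \<comment> \<open>The terms in \<open>i * b\<close> and in \<open>j * i * a\<close> cancel, and
      the two copies of \<open>- j * i * i * b\<close> are \<open>j * b\<close>.\<close>
    have "(1 - j * i) * (a + i * b) + (1 + j * i) * (a + (- i) * b) = 2 *\<^sub>R (a + j * b)"
      by (simp add: algebra_simps im_sphere_mult_mult[OF i] scaleR_2)
    then show ?thesis unfolding e by simp
  qed
  finally show "bergman_inner \<alpha> i ?K f = f w" .
qed

end
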